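(* Let $Q$ be a smooth manifold and let $R_d$ be a discretization map on $Q$. Then $R_d^{T}=TR_d\circ\kappa_Q$, where $\kappa_Q\colon TTQ\to TTQ$ is the canonical involution, is a discretization map on $TQ$.
   Context: Discretization map: let $M$ be a smooth manifold and $U\subset TM$ an open neighborhood of the zero section. A smooth map $R_d\colon U\to M\times M$, $R_d(x,v)=(R^1(x,v),R^2(x,v))$, is a discretization map on $M$ if (1) $R_d(x,0)=(x,x)$ for all $x\in M$; and (2) for every $x\in M$, $T_{0_x}R^2_x-T_{0_x}R^1_x\colon T_{0_x}T_xM\simeq T_xM\to T_xM$ is the identity map of $T_xM$, where $R^a_x$ is the restriction of $R^a$ to (the part in $U$ of) $T_xM$, $a=1,2$, and $0_x$ is the zero vector of $T_xM$. For a discretization map on $TQ$ one takes $M=TQ$, with $TTQ=T(TQ)$ viewed as a vector bundle over $TQ$ through the canonical projection $\tau_{TQ}$. Canonical involution: $\kappa_Q\colon TTQ\to TTQ$ is given in canonical local coordinates $(q,v,\dot q,\dot v)$ of $TTQ$ (induced by fibered coordinates $(q,v)$ of $TQ$) by $\kappa_Q(q,v,\dot q,\dot v)=(q,\dot q,v,\dot v)$; equivalently $\kappa_Q\bigl(\frac{\partial}{\partial t}\frac{\partial}{\partial s}\Phi(t,s)\bigr)=\frac{\partial}{\partial s}\frac{\partial}{\partial t}\Phi(t,s)$ for smooth maps $\Phi$ from open subsets of $\mathbb{R}^2$ to $Q$. Conventions: $TR_d$ is the tangent map of $R_d$, and $T(Q\times Q)$ is identified with $TQ\times TQ$ in the natural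 way, so that $R_d^T$ takes values in $TQ\times TQ$. If $R_d$ is defined only on an open neighborhood $U\subset TQ$ of the zero section, then $R_d^T$ is defined on $\kappa_Q(TU)$, an open neighborhood of the zero section of $\tau_{TQ}\colon TTQ\to TQ$. *)

theory Defs
  imports "HOL-Analysis.Analysis"
begin

text \<open>
  Smooth manifolds are given by an atlas, from which the carrier set and the topology are recovered.
  The model space is a finite-dimensional real inner product space; the class
  \<open>euclidean_space\<close> is avoided only because it excludes dimension 0.
\<close>


subsection \<open>Smooth maps between open subsets of model spaces\<close>

text \<open>Both predicates are meant for an open set \<open>S\<close> in a finite-dimensional space.\<close>

primrec Ck_on ::
  "nat \<Rightarrow> ('e::real_normed_vector \<Rightarrow> 'f::real_normed_vector) \<Rightarrow> 'e set \<Rightarrow> bool" where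
  "Ck_on 0 f S \<longleftrightarrow> continuous_on S f"
| "Ck_on (Suc k) f S \<longleftrightarrow>
     (\<forall>x\<in>S. f differentiable (at x)) \<and> (\<forall>v. Ck_on k (\<lambda>x. frechet_derivative f (at x) v) S)"

definition smooth_on :: "('e::real_normed_vector \<Rightarrow> 'f::real_normed_vector) \<Rightarrow> 'e set \<Rightarrow> bool" where
  "smooth_on f S \<longleftrightarrow> (\<forall>k. Ck_on k f S)"


subsection \<open>Smooth manifolds and smooth maps\<close>

text \<open>The values of \<open>chart_map c\<close> outside \<open>chart_dom c\<close> are irrelevant.\<close>

datatype ('a, 'e) chart = Chart (chart_dom: "'a set") (chart_map: "'a \<Rightarrow> 'e")

type_synonym ('a, 'e) atlas = "('a, 'e) chart set"

definition chart_inv :: "('a, 'e) chart \<Rightarrow> 'e \<Rightarrow> 'a" where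
  "chart_inv c = inv_into (chart_dom c) (chart_map c)"

definition carrier :: "('a, 'e) atlas \<Rightarrow> 'a set" where
  "carrier M = (\<Union>c\<in>M. chart_dom c)"

definition smooth_atlas :: "('a, 'e::real_inner) atlas \<Rightarrow> bool" where
  "smooth_atlas M \<longleftrightarrow>
     (\<forall>c\<in>M. inj_on (chart_map c) (chart_dom c) \<and> open (chart_map c ` chart_dom c)) \<and>
     (\<forall>c\<in>M. \<forall>d\<in>M.
        open (chart_map c ` (chart_dom c \<inter> chart_dom d)) \<and>
        smooth_on (chart_map d \<circ> chart_inv c) (chart_map c ` (chart_dom c \<inter> chart_dom d)))"

definition atlas_topology :: "('a, 'e::real_inner) atlas \<Rightarrow> 'a topology" where
  "atlas_topology M = topology (\<lambda>S. S \<subseteq> carrier M \<and> (\<forall>c\<in>M. open (chart_map c ` (S \<inter> chart_dom c))))"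

lemma openin_atlas_topology:
  assumes "smooth_atlas M"
  shows "openin (atlas_topology M) S \<longleftrightarrow>
           S \<subseteq> carrier M \<and> (\<forall>c\<in>M. open (chart_map c ` (S \<inter> chart_dom c)))"
proof -
  have inj: "inj_on (chart_map c) (chart_dom c)" if "c \<in> M" for c
    using assms that by (auto simp: smooth_atlas_def)
  have "istopology (\<lambda>S. S \<subseteq> carrier M \<and> (\<forall>c\<in>M. open (chart_map c ` (S \<inter> chart_dom c))))"
    unfolding istopology_def
  proof (intro conjI allI impI ballI)
    fix S T c
    assume ST: "S \<subseteq> carrier M \<and> (\<forall>c\<in>M. open (chart_map c ` (S \<inter> chart_dom c)))"
      "T \<subseteq> carrier M \<and> (\<forall>c\<in>M. open (chart_map c ` (T \<inter> chart_dom c)))" and c: "c \<in> M"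
    have "chart_map c ` (S \<inter> T \<inter> chart_dom c) =
            chart_map c ` (S \<inter> chart_dom c) \<inter> chart_map c ` (T \<inter> chart_dom c)"
      using inj_on_image_Int[OF inj[OF c], of "S \<inter> chart_dom c" "T \<inter> chart_dom c"]
      by (simp add: Int_ac)
    then show "open (chart_map c ` (S \<inter> T \<inter> chart_dom c))"
      using ST c by auto
  next
    fix K c
    assume K: "\<forall>S\<in>K. S \<subseteq> carrier M \<and> (\<forall>c\<in>M. open (chart_map c ` (S \<inter> chart_dom c)))"
      and c: "c \<in> M"
    have "chart_map c ` (\<Union>K \<inter> chart_dom c) = (\<Union>S\<in>K. chart_map c ` (S \<inter> chart_dom c))"
      by auto
    then show "open (chart_map c ` (\<Union>K \<inter> chart_dom c))"
      using K c by auto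
  qed auto
  then show ?thesis
    by (simp add: atlas_topology_def topology_inverse')
qed

definition smooth_manifold :: "('a, 'e::real_inner) atlas \<Rightarrow> bool" where
  "smooth_manifold M \<longleftrightarrow>
     (\<exists>B::'e set. finite B \<and> span B = UNIV) \<and>
     smooth_atlas M \<and>
     Hausdorff_space (atlas_topology M) \<and>
     second_countable (atlas_topology M)"

definition smooth_map_on ::
  "('a, 'e::real_inner) atlas \<Rightarrow> ('b, 'f::real_inner) atlas \<Rightarrow> 'a set \<Rightarrow> ('a \<Rightarrow> 'b) \<Rightarrow> bool" where
  "smooth_map_on M N U f \<longleftrightarrow>
     openin (atlas_topology M) U \<and>
     (\<forall>p\<in>U. \<exists>c\<in>M. \<exists>d\<in>N. \<exists>W.
        openin (atlas_topology M) W \<and> p \<in> W \<and> W \<subseteq> U \<inter> chart_dom c \<and> f ` W \<subseteq> chart_dom d \<and>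
        smooth_on (chart_map d \<circ> f \<circ> chart_inv c) (chart_map c ` W))"

definition product_manifold ::
  "('a, 'e) atlas \<Rightarrow> ('b, 'f) atlas \<Rightarrow> ('a \<times> 'b, 'e \<times> 'f) atlas" where
  "product_manifold M N =
     {Chart (chart_dom c \<times> chart_dom d) (\<lambda>(x, y). (chart_map c x, chart_map d y)) |c d. c \<in> M \<and> d \<in> N}"


subsection \<open>Tangent bundle and tangent maps\<close>

text \<open>
  A tangent vector at \<open>p\<close> is the family of its components with respect to all charts around \<open>p\<close>,
  related to each other by the derivatives of the transition maps.  Entries of the family at
  other charts are set to 0, so that families are equal iff they represent the same vector; the
  vector space operations of the tangent space are the pointwise ones.
\<close>

definition tangent_space :: "('a, 'e::real_inner) atlas \<Rightarrow> 'a \<Rightarrow> (('a, 'e) chart \<Rightarrow> 'e) set" where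
  "tangent_space M p =
     {v. (\<forall>c\<in>M. \<forall>d\<in>M. p \<in> chart_dom c \<and> p \<in> chart_dom d \<longrightarrow>
            v d = frechet_derivative (chart_map d \<circ> chart_inv c) (at (chart_map c p)) (v c)) \<and>
         (\<forall>c. c \<notin> M \<or> p \<notin> chart_dom c \<longrightarrow> v c = 0)}"

type_synonym ('a, 'e) tangent = "'a \<times> (('a, 'e) chart \<Rightarrow> 'e)"

definition zero_vector :: "'a \<Rightarrow> ('a, 'e::real_inner) tangent" where
  "zero_vector p = (p, \<lambda>c. 0)"

definition tangent_chart ::
  "('a, 'e::real_inner) atlas \<Rightarrow> ('a, 'e) chart \<Rightarrow> (('a, 'e) tangent, 'e \<times> 'e) chart" where
  "tangent_chart M c = Chart (Sigma (chart_dom c) (tangent_space M)) (\<lambda>(p, v). (chart_map c p, v c))"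

definition tangent_bundle ::
  "('a, 'e::real_inner) atlas \<Rightarrow> (('a, 'e) tangent, 'e \<times> 'e) atlas" where
  "tangent_bundle M = tangent_chart M ` M"

text \<open>
  The description below singles out the component, in the chart \<open>d\<close>, of the image of a vector
  at \<open>p\<close>; it does not depend on the chart \<open>c\<close> around \<open>p\<close> when \<open>f\<close> is smooth near \<open>p\<close>.
\<close>

definition tangent_map ::
  "('a, 'e::real_inner) atlas \<Rightarrow> ('b, 'f::real_inner) atlas \<Rightarrow> ('a \<Rightarrow> 'b) \<Rightarrow>
     ('a, 'e) tangent \<Rightarrow> ('b, 'f) tangent" where
  "tangent_map M N f = (\<lambda>(p, v).
     (f p, \<lambda>d. if d \<in> N \<and> f p \<in> chart_dom d
        then THE w. \<forall>c\<in>M. p \<in> chart_dom c \<longrightarrow>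
          w = frechet_derivative (chart_map d \<circ> f \<circ> chart_inv c) (at (chart_map c p)) (v c)
        else 0))"

text \<open>The natural identification of \<open>T(M \<times> N)\<close> with \<open>TM \<times> TN\<close>.\<close>

definition tangent_product ::
  "('a, 'e::real_inner) atlas \<Rightarrow> ('b, 'f::real_inner) atlas \<Rightarrow>
     ('a \<times> 'b, 'e \<times> 'f) tangent \<Rightarrow> ('a, 'e) tangent \<times> ('b, 'f) tangent" where
  "tangent_product M N \<xi> =
     (tangent_map (product_manifold M N) M fst \<xi>, tangent_map (product_manifold M N) N snd \<xi>)"

text \<open>
  The canonical involution, given by \<open>(q, v, q', v') \<mapsto> (q, q', v, v')\<close> in the coordinates on the
  double tangent bundle that are induced by any chart of \<open>Q\<close>.
\<close>

definition canonical_involution ::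
  "('a, 'e::real_inner) atlas \<Rightarrow>
     (('a, 'e) tangent, 'e \<times> 'e) tangent \<Rightarrow> (('a, 'e) tangent, 'e \<times> 'e) tangent" where
  "canonical_involution Q \<xi> = (THE \<eta>. \<forall>c\<in>Q.
     let C = tangent_chart (tangent_bundle Q) (tangent_chart Q c) in
       \<xi> \<in> chart_dom C \<longrightarrow>
       \<eta> \<in> chart_dom C \<and>
       chart_map C \<eta> = (\<lambda>((q, v), (q', v')). ((q, q'), (v, v'))) (chart_map C \<xi>))"


subsection \<open>Discretization maps\<close>

text \<open>
  The tangent space at \<open>x\<close> as a manifold: every chart of \<open>M\<close> around \<open>x\<close> induces a linear chart.
\<close>

definition fibre_manifold ::
  "('a, 'e::real_inner) atlas \<Rightarrow> 'a \<Rightarrow> (('a, 'e) chart \<Rightarrow> 'e, 'e) atlas" where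
  "fibre_manifold M x = {Chart (tangent_space M x) (\<lambda>v. v c) |c. c \<in> M \<and> x \<in> chart_dom c}"

text \<open>
  The canonical isomorphism of \<open>T\<^sub>xM\<close> with its tangent space at the origin: the components of the
  image of \<open>v\<close> are the coordinates of \<open>v\<close> in the linear charts.
\<close>

definition fibre_iso ::
  "('a, 'e::real_inner) atlas \<Rightarrow> 'a \<Rightarrow> (('a, 'e) chart \<Rightarrow> 'e) \<Rightarrow>
     (('a, 'e) chart \<Rightarrow> 'e, 'e) tangent" where
  "fibre_iso M x v = (\<lambda>c. 0, \<lambda>k. if k \<in> fibre_manifold M x then chart_map k v else 0)"

text \<open>
  The tangent map at the origin of the restriction of \<open>f\<close> to the fibre over \<open>x\<close>, as a map from
  \<open>T\<^sub>xM\<close> to the tangent space of \<open>M\<close> at the image of the zero vector.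
\<close>

definition fibre_derivative ::
  "('a, 'e::real_inner) atlas \<Rightarrow> (('a, 'e) tangent \<Rightarrow> 'a) \<Rightarrow> 'a \<Rightarrow>
     (('a, 'e) chart \<Rightarrow> 'e) \<Rightarrow> (('a, 'e) chart \<Rightarrow> 'e)" where
  "fibre_derivative M f x v =
     snd (tangent_map (fibre_manifold M x) M (\<lambda>w. f (x, w)) (fibre_iso M x v))"

definition discretization_map ::
  "('a, 'e::real_inner) atlas \<Rightarrow> ('a, 'e) tangent set \<Rightarrow> (('a, 'e) tangent \<Rightarrow> 'a \<times> 'a) \<Rightarrow> bool" where
  "discretization_map M U R \<longleftrightarrow>
     smooth_manifold M \<and>
     openin (atlas_topology (tangent_bundle M)) U \<and>
     (\<forall>x\<in>carrier M. zero_vector x \<in> U) \<and>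
     smooth_map_on (tangent_bundle M) (product_manifold M M) U R \<and>
     (\<forall>x\<in>carrier M. R (zero_vector x) = (x, x)) \<and>
     (\<forall>x\<in>carrier M. \<forall>v\<in>tangent_space M x.
        (\<lambda>c. fibre_derivative M (snd \<circ> R) x v c - fibre_derivative M (fst \<circ> R) x v c) = v)"

definition tangent_lift ::
  "('a, 'e::real_inner) atlas \<Rightarrow> (('a, 'e) tangent \<Rightarrow> 'a \<times> 'a) \<Rightarrow>
     (('a, 'e) tangent, 'e \<times> 'e) tangent \<Rightarrow> ('a, 'e) tangent \<times> ('a, 'e) tangent" where
  "tangent_lift Q R =
     tangent_product Q Q \<circ> tangent_map (tangent_bundle Q) (product_manifold Q Q) R \<circ>
       canonical_involution Q"

text \<open>The tangent bundle of the open subset \<open>U\<close> of \<open>M\<close>, as an open subset of \<open>TM\<close>.\<close>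

definition tangent_over :: "('a, 'e::real_inner) atlas \<Rightarrow> 'a set \<Rightarrow> ('a, 'e) tangent set" where
  "tangent_over M U = Sigma U (tangent_space M)"

end

theory Submission
  imports Defs
begin

text \<open>
  Write \<open>T f (x, v) = (f x, D f x v)\<close> for the tangent map in coordinates and
  \<open>\<sigma> ((q, v), (q', v')) = ((q, q'), (v, v'))\<close>.  Symmetry of second derivatives says that \<open>\<sigma>\<close> commutes with
  \<open>T (T f)\<close>; for transition maps \<open>f\<close> this makes the canonical involution well defined, with chart
  representation \<open>\<sigma>\<close>.  The identification \<open>T(Q \<times> Q) = TQ \<times> TQ\<close> is \<open>\<sigma>\<close> in charts as well, so the lift of \<open>R\<close>
  is \<open>\<sigma> \<circ> T r \<circ> \<sigma>\<close> where \<open>r\<close> represents \<open>R\<close>.  The normalization on zero vectors follows by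
  differentiating \<open>r (q, 0) = (q, q)\<close>.  The difference \<open>s = r\<^sup>2 - r\<^sup>1\<close> satisfies \<open>D s (q, 0) (0, a) = a\<close>
  for all \<open>q\<close>, and the fibre derivative of \<open>T s \<circ> \<sigma>\<close> at \<open>((q, v), 0)\<close> in direction \<open>(a, b)\<close> is
  \<open>(a, D\<^sup>2 s (q, 0) ((v, 0), (0, a)) + b)\<close>.  The second derivative vanishes, being the derivative along \<open>v\<close> of
  a constant, and what remains is the identity.
\<close>

section \<open>Calculus of smooth maps\<close>

text \<open>The involution is needed because the double tangent bundle has two vector bundle
  structures over the tangent bundle. In coordinates \<open>((q, v), (q', v'))\<close> one projects
  to \<open>(q, v)\<close>, with zeros \<open>((q, v), (0, 0))\<close>; the other projects to
  \<open>(q, q')\<close>, with zeros \<open>((q, 0), (q', 0))\<close>, the vectors tangent to the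
  zero section. Differentiating the properties of \<open>R\<close> on its zero section normalizes
  the tangent map of \<open>R\<close> for the second structure, while a discretization map refers to
  the first; the involution exchanges them. Two features of the definitions shape the proof.
  \<open>Ck_on\<close> differentiates in fixed directions only, whereas a tangent map has the
  direction as a variable; finite dimension bridges this, since a moving direction is a finite
  combination of fixed ones with smooth coefficients. Further, tangent maps and the involution are
  given by definite descriptions, and smoothness by charts that may change from point to point. Each
  notion is therefore first shown to have the expected expression in prescribed charts, and the
  geometric claims are then read off from coordinates.\<close>

definition fin_dim :: "'e::real_inner itself \<Rightarrow> bool" where
  "fin_dim _ \<longleftrightarrow> (\<exists>B::'e set. finite B \<and> span B = UNIV)"

text \<open>Orthogonality makes the coefficients explicit and bounded linear in \<open>x\<close>, so
  that they remain smooth when \<open>x\<close> is replaced by a smoothly varying vector.\<close>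

lemma fin_dim_expansion:
  assumes "fin_dim TYPE('e::real_inner)"
  obtains B :: "'e::real_inner set" where "finite B" "\<And>x. x = (\<Sum>b\<in>B. ((x \<bullet> b) / (b \<bullet> b)) *\<^sub>R b)"
proof -
  obtain B :: "'e set" where B: "finite B" "span B = UNIV"
    using assms by (auto simp: fin_dim_def)
  obtain C where C: "finite C" "span C = (UNIV :: 'e set)" "pairwise orthogonal C"
    using basis_orthogonal[OF B(1)] B(2) by metis
  have "x = (\<Sum>b\<in>C. ((x \<bullet> b) / (b \<bullet> b)) *\<^sub>R b)" for x :: 'e
  proof -
    have "x \<in> span C" using C by simp
    then obtain u where u: "x = (\<Sum>b\<in>C. u b *\<^sub>R b)"
      using span_finite[OF C(1)] by auto
    have "x \<bullet> c = u c * (c \<bullet> c)" if "c \<in> C" for c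
    proof -
      have "x \<bullet> c = (\<Sum>b\<in>C. u b * (b \<bullet> c))"
        by (simp add: u inner_sum_left)
      also have "\<dots> = (\<Sum>b\<in>C. if b = c then u c * (c \<bullet> c) else 0)"
        using C(3) that by (intro sum.cong) (auto simp: pairwise_def orthogonal_def)
      finally show ?thesis using C(1) that by simp
    qed
    \<comment> \<open>The orthogonal spanning set may contain the zero vector; for it both sides
      vanish, whatever the quotient is.\<close>
    then have "((x \<bullet> c) / (c \<bullet> c)) *\<^sub>R c = u c *\<^sub>R c" if "c \<in> C" for c
      using that by (cases "c = 0") auto
    then show ?thesis using u by (metis (mono_tags, lifting) sum.cong)
  qed
  then show ?thesis using that C(1) by blast
qed

lemma fin_dim_prod:
  assumes "fin_dim TYPE('e::real_inner)" "fin_dim TYPE('f::real_inner)"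
  shows "fin_dim TYPE('e::real_inner \<times> 'f::real_inner)"
proof -
  obtain B :: "'e set" where B: "finite B" "span B = UNIV"
    using assms by (auto simp: fin_dim_def)
  obtain C :: "'f set" where C: "finite C" "span C = UNIV"
    using assms by (auto simp: fin_dim_def)
  let ?D = "(\<lambda>b. (b, 0)) ` B \<union> (\<lambda>c. (0, c)) ` C"
  have "(x, y) \<in> span ?D" for x :: 'e and y :: 'f
  proof -
    have "linear (\<lambda>b::'e. (b, 0::'f))" "linear (\<lambda>c::'f. (0::'e, c))"
      by (auto intro!: linearI)
    then have "(x, 0) \<in> span ((\<lambda>b. (b, 0::'f)) ` B)" "(0, y) \<in> span ((\<lambda>c. (0::'e, c)) ` C)"
      using B C by (simp_all add: linear_span_image)
    then have "(x, 0) \<in> span ?D" "(0, y) \<in> span ?D"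
      by (meson span_mono subset_iff sup_ge1 sup_ge2)+
    then have "(x, 0) + (0, y) \<in> span ?D"
      by (rule span_add)
    then show ?thesis by simp
  qed
  then have "span ?D = UNIV" by auto
  then show ?thesis
    unfolding fin_dim_def using B C by (intro exI[of _ ?D]) auto
qed

section \<open>Maps of class C^k on open sets\<close>

lemma Ck_on_subset: "Ck_on k f S \<Longrightarrow> T \<subseteq> S \<Longrightarrow> Ck_on k f T"
  by (induction k arbitrary: f) (auto intro: continuous_on_subset)

text \<open>Openness makes \<open>f\<close> and \<open>g\<close> agree near each point, which
  equality of their full derivatives at that point requires.\<close>

lemma Ck_on_cong:
  assumes "open S" "\<And>x. x \<in> S \<Longrightarrow> f x = g x" "Ck_on k f S"
  shows "Ck_on k g S"
  using assms(2,3)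
proof (induction k arbitrary: f g)
  case 0
  then show ?case by (metis Ck_on.simps(1) continuous_on_cong)
next
  case (Suc k)
  have g: "(g has_derivative frechet_derivative f (at x)) (at x)" if "x \<in> S" for x
    using Suc.prems that assms(1)
    by (metis (no_types, lifting) Ck_on.simps(2) frechet_derivative_works
        has_derivative_transform_within_open)
  have "Ck_on k (\<lambda>x. frechet_derivative g (at x) v) S" for v
  proof (rule Suc.IH)
    show "frechet_derivative f (at x) v = frechet_derivative g (at x) v" if "x \<in> S" for x
      using frechet_derivative_at[OF g[OF that]] by simp
    show "Ck_on k (\<lambda>x. frechet_derivative f (at x) v) S"
      using Suc.prems by simp
  qed
  then show ?case
    using g by (auto simp: differentiable_def)
qed

text \<open>An explicitly known derivative \<open>f'\<close> may replace
  \<open>frechet_derivative\<close>. The inductions for sums, products and compositions below run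
  through this rule.\<close>

lemma Ck_on_SucI:
  assumes "open S" "\<And>x. x \<in> S \<Longrightarrow> (f has_derivative f' x) (at x)"
    and "\<And>v. Ck_on k (\<lambda>x. f' x v) S"
  shows "Ck_on (Suc k) f S"
proof -
  have "Ck_on k (\<lambda>x. frechet_derivative f (at x) v) S" for v
    using frechet_derivative_at[OF assms(2)]
    by (intro Ck_on_cong[OF assms(1) _ assms(3)[of v]]) auto
  then show ?thesis
    using assms(2) by (auto simp: differentiable_def)
qed

lemma Ck_on_Suc_has_derivative:
  "Ck_on (Suc k) f S \<Longrightarrow> x \<in> S \<Longrightarrow> (f has_derivative frechet_derivative f (at x)) (at x)"
  by (simp add: frechet_derivative_works[symmetric])

text \<open>Product and chain rule produce terms with an undifferentiated factor, which the
  induction hypothesis wants one class lower than given.\<close>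

lemma Ck_on_SucD: "Ck_on (Suc k) f S \<Longrightarrow> Ck_on k f S"
proof (induction k arbitrary: f)
  case 0
  then show ?case
    by (auto intro!: continuous_at_imp_continuous_on differentiable_imp_continuous_within)
next
  case (Suc k)
  then show ?case by (auto simp del: Ck_on.simps(1) intro: Suc.IH)
qed

lemma Ck_on_linear_compose:
  assumes "bounded_linear L" "open S" "Ck_on k f S"
  shows "Ck_on k (\<lambda>x. L (f x)) S"
  using assms(3)
proof (induction k arbitrary: f)
  case 0
  then show ?case
    using assms(1) by (auto intro: bounded_linear.continuous_on)
next
  case (Suc k)
  show ?case
  proof (rule Ck_on_SucI[OF assms(2)])
    show "((\<lambda>x. L (f x)) has_derivative (\<lambda>v. L (frechet_derivative f (at x) v))) (at x)"
      if "x \<in> S" for x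
      using Ck_on_Suc_has_derivative[OF Suc.prems that] assms(1)
      by (rule bounded_linear.has_derivative[rotated])
    show "Ck_on k (\<lambda>x. L (frechet_derivative f (at x) v)) S" for v
      using Suc by auto
  qed
qed

lemma Ck_on_const: "open S \<Longrightarrow> Ck_on k (\<lambda>x. c) S"
  by (induction k arbitrary: c) auto

lemma Ck_on_bounded_linear:
  assumes "bounded_linear L" "open S"
  shows "Ck_on k L S"
proof (cases k)
  case 0
  then show ?thesis
    using assms by (simp add: linear_continuous_on)
next
  case (Suc n)
  show ?thesis
    unfolding Suc
    by (rule Ck_on_SucI[OF assms(2) bounded_linear_imp_has_derivative[OF assms(1)]])
      (rule Ck_on_const[OF assms(2)])
qed

lemma Ck_on_add:
  assumes "open S" "Ck_on k f S" "Ck_on k g S"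
  shows "Ck_on k (\<lambda>x. f x + g x) S"
  using assms(2,3)
proof (induction k arbitrary: f g)
  case 0
  then show ?case by (auto intro: continuous_on_add)
next
  case (Suc k)
  show ?case
  proof (rule Ck_on_SucI[OF assms(1)])
    show "((\<lambda>x. f x + g x) has_derivative
        (\<lambda>v. frechet_derivative f (at x) v + frechet_derivative g (at x) v)) (at x)" if "x \<in> S" for x
      using that Suc.prems by (intro has_derivative_add Ck_on_Suc_has_derivative)
    show "Ck_on k (\<lambda>x. frechet_derivative f (at x) v + frechet_derivative g (at x) v) S" for v
      using Suc by auto
  qed
qed

lemma Ck_on_sum:
  assumes "open S" "finite I" "\<And>i. i \<in> I \<Longrightarrow> Ck_on k (f i) S"
  shows "Ck_on k (\<lambda>x. \<Sum>i\<in>I. f i x) S"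
  using assms(2,3)
  by (induction I rule: finite_induct) (auto intro!: Ck_on_const Ck_on_add assms(1))

lemma Ck_on_scaleR:
  assumes "open S" "Ck_on k f S" "Ck_on k g S"
  shows "Ck_on k (\<lambda>x. f x *\<^sub>R g x) S"
  using assms(2,3)
proof (induction k arbitrary: f g)
  case 0
  then show ?case by (auto intro: continuous_on_scaleR)
next
  case (Suc k)
  show ?case
  proof (rule Ck_on_SucI[OF assms(1)])
    show "((\<lambda>x. f x *\<^sub>R g x) has_derivative
        (\<lambda>v. f x *\<^sub>R frechet_derivative g (at x) v + frechet_derivative f (at x) v *\<^sub>R g x)) (at x)"
      if "x \<in> S" for x
      using that Suc.prems by (intro has_derivative_scaleR Ck_on_Suc_has_derivative)
    show "Ck_on k (\<lambda>x. f x *\<^sub>R frechet_derivative g (at x) v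
        + frechet_derivative f (at x) v *\<^sub>R g x) S" for v
      using Suc.prems Suc.IH Ck_on_SucD[OF Suc.prems(1)] Ck_on_SucD[OF Suc.prems(2)]
      by (intro Ck_on_add assms(1)) auto
  qed
qed

text \<open>A pair is the sum of two linear images, which reduces the claim to closure properties
  already shown.\<close>

lemma Ck_on_Pair:
  assumes "open S" "Ck_on k f S" "Ck_on k g S"
  shows "Ck_on k (\<lambda>x. (f x, g x)) S"
proof -
  have "Ck_on k (\<lambda>x. (f x, 0) + (0, g x)) S"
    by (intro Ck_on_add assms(1) Ck_on_linear_compose[OF _ assms(1) assms(2)]
        Ck_on_linear_compose[OF _ assms(1) assms(3)] bounded_linear_Pair bounded_linear_ident
        bounded_linear_zero)
  then show ?thesis by simp
qed

text \<open>The chain rule involves the derivative of the outer map at a moving point and in a moving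
  direction; expanding the direction in an orthogonal basis reduces this to the fixed directions
  that occur in the definition of \<open>Ck_on\<close>.\<close>

lemma linear_expansion:
  assumes "linear L" "x = (\<Sum>b\<in>B. (x \<bullet> b / (b \<bullet> b)) *\<^sub>R b)"
  shows "L x = (\<Sum>b\<in>B. (x \<bullet> b / (b \<bullet> b)) *\<^sub>R L b)"
  by (subst assms(2)) (simp add: linear_sum[OF assms(1)] linear_scale[OF assms(1)])

lemma bounded_linear_coord: "bounded_linear (\<lambda>x. (x \<bullet> b) / c)"
  by (rule bounded_linear_compose[OF bounded_linear_divide bounded_linear_inner_left])

lemma Ck_on_compose:
  fixes f :: "'e::real_normed_vector \<Rightarrow> 'f::real_inner" and g :: "'f \<Rightarrow> 'g::real_normed_vector"
  assumes "fin_dim TYPE('f)" "open S" "open T" "f ` S \<subseteq> T" "Ck_on k f S" "Ck_on k g T"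
  shows "Ck_on k (\<lambda>x. g (f x)) S"
  using assms(5,6)
proof (induction k arbitrary: g)
  case 0
  then show ?case
    using assms(4) by (auto intro: continuous_on_compose2)
next
  case (Suc k)
  obtain B :: "'f set" where B: "finite B" "\<And>x. x = (\<Sum>b\<in>B. ((x \<bullet> b) / (b \<bullet> b)) *\<^sub>R b)"
    using fin_dim_expansion[OF assms(1)] by metis
  let ?c = "\<lambda>x v b. (frechet_derivative f (at x) v \<bullet> b) / (b \<bullet> b)"
  show ?case
  proof (rule Ck_on_SucI[OF assms(2)])
    show "((\<lambda>x. g (f x)) has_derivative
        (\<lambda>v. \<Sum>b\<in>B. ?c x v b *\<^sub>R frechet_derivative g (at (f x)) b)) (at x)" if "x \<in> S" for x
    proof -
      have g: "(g has_derivative frechet_derivative g (at (f x))) (at (f x))"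
        using Suc.prems(2) that assms(4) by (auto simp: frechet_derivative_works[symmetric])
      have "((\<lambda>x. g (f x)) has_derivative
          (\<lambda>v. frechet_derivative g (at (f x)) (frechet_derivative f (at x) v))) (at x)"
        using has_derivative_compose[OF Ck_on_Suc_has_derivative[OF Suc.prems(1) that] g] .
      moreover have "frechet_derivative g (at (f x)) (frechet_derivative f (at x) v) =
          (\<Sum>b\<in>B. ?c x v b *\<^sub>R frechet_derivative g (at (f x)) b)" for v
        by (rule linear_expansion[OF has_derivative_linear[OF g] B(2)])
      ultimately show ?thesis by simp
    qed
    have "Ck_on k (\<lambda>x. ?c x v b) S" for v b
      using Suc.prems(1)
      by (intro Ck_on_linear_compose[OF bounded_linear_coord assms(2)]) simp
    \<comment> \<open>The induction hypothesis is taken for the outer map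
      \<open>y \<mapsto> frechet_derivative g (at y) b\<close>; the inner map stays the same and
      only loses one class of differentiability.\<close>
    moreover have "Ck_on k (\<lambda>x. frechet_derivative g (at (f x)) b) S" for b
      using Suc.IH[OF Ck_on_SucD[OF Suc.prems(1)], of "\<lambda>y. frechet_derivative g (at y) b"] Suc.prems(2)
      by simp
    ultimately show "Ck_on k (\<lambda>x. \<Sum>b\<in>B. ?c x v b *\<^sub>R frechet_derivative g (at (f x)) b) S" for v
      by (intro Ck_on_sum Ck_on_scaleR assms(2) B(1))
  qed
qed

lemma Ck_on_local:
  assumes "\<And>x. x \<in> S \<Longrightarrow> \<exists>T. open T \<and> x \<in> T \<and> Ck_on k f T"
  shows "Ck_on k f S"
  using assms
proof (induction k arbitrary: f)
  case 0
  then show ?case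
    by (metis Ck_on.simps(1) continuous_at_imp_continuous_on continuous_on_eq_continuous_at)
next
  case (Suc k)
  have "Ck_on k (\<lambda>x. frechet_derivative f (at x) v) S" for v
    by (rule Suc.IH) (use Suc.prems in fastforce)
  then show ?case
    using Suc.prems by fastforce
qed

section \<open>Smooth maps on open sets\<close>

lemma smooth_on_subset: "smooth_on f S \<Longrightarrow> T \<subseteq> S \<Longrightarrow> smooth_on f T"
  unfolding smooth_on_def by (blast intro: Ck_on_subset)

lemma smooth_on_cong:
  "open S \<Longrightarrow> (\<And>x. x \<in> S \<Longrightarrow> f x = g x) \<Longrightarrow> smooth_on f S \<Longrightarrow> smooth_on g S"
  unfolding smooth_on_def by (blast intro: Ck_on_cong)

lemma smooth_on_local:
  "(\<And>x. x \<in> S \<Longrightarrow> \<exists>T. open T \<and> x \<in> T \<and> smooth_on f T) \<Longrightarrow> smooth_on f S"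
  unfolding smooth_on_def by (rule allI, rule Ck_on_local) metis

lemma smooth_on_bounded_linear: "bounded_linear L \<Longrightarrow> open S \<Longrightarrow> smooth_on L S"
  unfolding smooth_on_def by (blast intro: Ck_on_bounded_linear)

lemma smooth_on_linear_compose:
  "bounded_linear L \<Longrightarrow> open S \<Longrightarrow> smooth_on f S \<Longrightarrow> smooth_on (\<lambda>x. L (f x)) S"
  unfolding smooth_on_def by (blast intro: Ck_on_linear_compose)

lemma smooth_on_Pair:
  "open S \<Longrightarrow> smooth_on f S \<Longrightarrow> smooth_on g S \<Longrightarrow> smooth_on (\<lambda>x. (f x, g x)) S"
  unfolding smooth_on_def by (blast intro: Ck_on_Pair)

lemma smooth_on_compose:
  fixes f :: "'e::real_normed_vector \<Rightarrow> 'f::real_inner" and g :: "'f \<Rightarrow> 'g::real_normed_vector"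
  assumes "fin_dim TYPE('f)" "open S" "open T" "f ` S \<subseteq> T" "smooth_on f S" "smooth_on g T"
  shows "smooth_on (\<lambda>x. g (f x)) S"
  using assms unfolding smooth_on_def by (blast intro: Ck_on_compose)

lemma smooth_on_continuous_on: "smooth_on f S \<Longrightarrow> continuous_on S f"
  unfolding smooth_on_def by (metis Ck_on.simps(1))

lemma smooth_on_has_derivative:
  "smooth_on f S \<Longrightarrow> x \<in> S \<Longrightarrow> (f has_derivative frechet_derivative f (at x)) (at x)"
  unfolding smooth_on_def by (blast intro: Ck_on_Suc_has_derivative)

lemma smooth_on_frechet_derivative:
  "smooth_on f S \<Longrightarrow> smooth_on (\<lambda>x. frechet_derivative f (at x) v) S"
  unfolding smooth_on_def by (metis Ck_on.simps(2))

subsection \<open>Symmetry of second derivatives\<close>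

text \<open>The mean value theorem is applied twice: in direction \<open>u\<close> to the increment
  of \<open>g\<close> along \<open>h v\<close>, then in direction \<open>v\<close> to the resulting
  directional derivative. The second difference on the left is symmetric in \<open>u\<close> and
  \<open>v\<close>, which is its purpose.\<close>

lemma double_mean_value:
  fixes g :: "'e::real_normed_vector \<Rightarrow> real"
  assumes g: "smooth_on g S" and S: "\<And>s t. 0 \<le> s \<Longrightarrow> s \<le> h \<Longrightarrow> 0 \<le> t \<Longrightarrow> t \<le> h \<Longrightarrow> x + s *\<^sub>R u + t *\<^sub>R v \<in> S"
    and h: "0 < h"
  shows "\<exists>s t. 0 < s \<and> s < h \<and> 0 < t \<and> t < h \<and>
    g (x + h *\<^sub>R u + h *\<^sub>R v) - g (x + h *\<^sub>R u) - g (x + h *\<^sub>R v) + g x =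
      h * h * frechet_derivative (\<lambda>y. frechet_derivative g (at y) u) (at (x + s *\<^sub>R u + t *\<^sub>R v)) v"
proof -
  let ?D = "\<lambda>y. frechet_derivative g (at y) u"
  have D1: "DERIV (\<lambda>s. g (x + s *\<^sub>R u + t *\<^sub>R v)) s :> ?D (x + s *\<^sub>R u + t *\<^sub>R v)"
    if "0 \<le> s" "s \<le> h" "0 \<le> t" "t \<le> h" for s t
  proof -
    have gd: "(g has_derivative frechet_derivative g (at (x + s *\<^sub>R u + t *\<^sub>R v)))
        (at (x + s *\<^sub>R u + t *\<^sub>R v))"
      using smooth_on_has_derivative[OF g S[OF that]] .
    have "((\<lambda>s. x + s *\<^sub>R u + t *\<^sub>R v) has_derivative (\<lambda>r. r *\<^sub>R u)) (at s)"
      by (auto intro!: derivative_eq_intros)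
    from has_derivative_compose[OF this gd]
    show ?thesis
      by (simp add: has_field_derivative_def linear_scale[OF has_derivative_linear[OF gd]])
         (simp add: mult_commute_abs)
  qed
  have D2: "DERIV (\<lambda>t. ?D (x + s *\<^sub>R u + t *\<^sub>R v)) t :>
      frechet_derivative ?D (at (x + s *\<^sub>R u + t *\<^sub>R v)) v"
    if "0 \<le> s" "s \<le> h" "0 \<le> t" "t \<le> h" for s t
  proof -
    have gd: "(?D has_derivative frechet_derivative ?D (at (x + s *\<^sub>R u + t *\<^sub>R v)))
        (at (x + s *\<^sub>R u + t *\<^sub>R v))"
      using smooth_on_has_derivative[OF smooth_on_frechet_derivative[OF g] S[OF that]] .
    have "((\<lambda>t. x + s *\<^sub>R u + t *\<^sub>R v) has_derivative (\<lambda>r. r *\<^sub>R v)) (at t)"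
      by (auto intro!: derivative_eq_intros)
    from has_derivative_compose[OF this gd]
    show ?thesis
      by (simp add: has_field_derivative_def linear_scale[OF has_derivative_linear[OF gd]])
         (simp add: mult_commute_abs)
  qed
  \<comment> \<open>The function of one variable is
    \<open>s \<mapsto> g (x + s u + h v) - g (x + s u)\<close>; the summands with factor 0 keep it
    in the form covered by \<open>D1\<close>.\<close>
  have "\<exists>s. 0 < s \<and> s < h \<and>
      (g (x + h *\<^sub>R u + h *\<^sub>R v) - g (x + h *\<^sub>R u + 0 *\<^sub>R v))
      - (g (x + 0 *\<^sub>R u + h *\<^sub>R v) - g (x + 0 *\<^sub>R u + 0 *\<^sub>R v)) =
      (h - 0) * (?D (x + s *\<^sub>R u + h *\<^sub>R v) - ?D (x + s *\<^sub>R u + 0 *\<^sub>R v))"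
    by (rule MVT2[OF h]) (use h in \<open>intro DERIV_diff D1, auto\<close>)
  then obtain s where s: "0 < s" "s < h"
      "g (x + h *\<^sub>R u + h *\<^sub>R v) - g (x + h *\<^sub>R u) - g (x + h *\<^sub>R v) + g x =
      h * (?D (x + s *\<^sub>R u + h *\<^sub>R v) - ?D (x + s *\<^sub>R u + 0 *\<^sub>R v))"
    by (auto simp: algebra_simps)
  have "\<exists>t. 0 < t \<and> t < h \<and> ?D (x + s *\<^sub>R u + h *\<^sub>R v) - ?D (x + s *\<^sub>R u + 0 *\<^sub>R v)
      = (h - 0) * frechet_derivative ?D (at (x + s *\<^sub>R u + t *\<^sub>R v)) v"
    by (rule MVT2[OF h]) (use s in \<open>intro D2, auto\<close>)
  then obtain t where t: "0 < t" "t < h" "?D (x + s *\<^sub>R u + h *\<^sub>R v) - ?D (x + s *\<^sub>R u + 0 *\<^sub>R v)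
      = h * frechet_derivative ?D (at (x + s *\<^sub>R u + t *\<^sub>R v)) v"
    by auto
  show ?thesis
    by (rule exI[of _ s], rule exI[of _ t]) (simp only: s t mult.assoc simp_thms)
qed

text \<open>The same second difference equals \<open>h * h\<close> times either mixed derivative,
  each at some point of a small parallelogram at \<open>x\<close>. So the two mixed derivatives
  share a value arbitrarily close to \<open>x\<close>, and continuity makes them equal at
  \<open>x\<close>.\<close>

lemma symmetric_second_derivative_real:
  fixes g :: "'e::real_normed_vector \<Rightarrow> real"
  assumes g: "smooth_on g S" and S: "open S" "x \<in> S"
  shows "frechet_derivative (\<lambda>y. frechet_derivative g (at y) u) (at x) v =
    frechet_derivative (\<lambda>y. frechet_derivative g (at y) v) (at x) u"
proof -
  define G where "G u v y = frechet_derivative (\<lambda>y. frechet_derivative g (at y) u) (at y) v" for u v y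
  have cont: "continuous (at x) (G u v)" for u v
    unfolding G_def
    using S smooth_on_continuous_on[OF smooth_on_frechet_derivative[OF smooth_on_frechet_derivative[OF g]]]
    by (auto simp: continuous_on_eq_continuous_at)
  have "dist (G u v x) (G v u x) < e" if "0 < e" for e
  proof -
    obtain d1 where d1: "0 < d1" "\<And>y. dist y x < d1 \<Longrightarrow> dist (G u v y) (G u v x) < e / 2"
      using cont[of u v] \<open>0 < e\<close> by (metis continuous_at_eps_delta half_gt_zero)
    obtain d2 where d2: "0 < d2" "\<And>y. dist y x < d2 \<Longrightarrow> dist (G v u y) (G v u x) < e / 2"
      using cont[of v u] \<open>0 < e\<close> by (metis continuous_at_eps_delta half_gt_zero)
    obtain d3 where d3: "0 < d3" "\<And>y. dist y x < d3 \<Longrightarrow> y \<in> S"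
      using S by (metis open_dist)
    define d where "d = min d1 (min d2 d3)"
    \<comment> \<open>With this side length the whole parallelogram spanned by \<open>h u\<close>
      and \<open>h v\<close> stays within distance \<open>d\<close> of \<open>x\<close>; the summand
      1 keeps the denominator positive when \<open>u\<close> and \<open>v\<close> vanish.\<close>
    define h where "h = d / (2 * (norm u + norm v + 1))"
    have h: "0 < h"
      using d1 d2 d3 by (auto simp: h_def d_def intro!: divide_pos_pos add_nonneg_pos)
    have near: "dist (x + s *\<^sub>R u + t *\<^sub>R v) x < d" "dist (x + s *\<^sub>R v + t *\<^sub>R u) x < d"
      if "0 \<le> s" "s \<le> h" "0 \<le> t" "t \<le> h" for s t
    proof -
      have *: "norm (s *\<^sub>R u + t *\<^sub>R v) < d" if "0 \<le> s" "s \<le> h" "0 \<le> t" "t \<le> h" for s t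
      proof -
        have "norm (s *\<^sub>R u + t *\<^sub>R v) \<le> s * norm u + t * norm v"
          using that by (intro norm_triangle_le) auto
        also have "\<dots> \<le> h * norm u + h * norm v"
          using that by (intro add_mono mult_right_mono) auto
        also have "\<dots> = h * (norm u + norm v)"
          by (simp add: distrib_left)
        also have "\<dots> < h * (2 * (norm u + norm v + 1))"
        proof (rule mult_strict_left_mono[OF _ h])
          show "norm u + norm v < 2 * (norm u + norm v + 1)"
            using norm_ge_zero[of u] norm_ge_zero[of v] by argo
        qed
        also have "\<dots> = d"
        proof -
          have "2 * (norm u + norm v + 1) \<noteq> 0"
            using norm_ge_zero[of u] norm_ge_zero[of v] by argo
          then show ?thesis
            unfolding h_def by (rule nonzero_eq_divide_eq[THEN iffD1]) simp
        qed
        finally show ?thesis .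
      qed
      show "dist (x + s *\<^sub>R u + t *\<^sub>R v) x < d" "dist (x + s *\<^sub>R v + t *\<^sub>R u) x < d"
        using *[OF that] *[OF that(3,4,1,2)] by (simp_all add: dist_norm add.commute add.left_commute)
    qed
    obtain s t where st: "0 < s" "s < h" "0 < t" "t < h"
      "g (x + h *\<^sub>R u + h *\<^sub>R v) - g (x + h *\<^sub>R u) - g (x + h *\<^sub>R v) + g x =
        h * h * G u v (x + s *\<^sub>R u + t *\<^sub>R v)"
      using double_mean_value[OF g _ h, of x u v] d3(2) near(1) by (auto simp: G_def d_def)
    obtain s' t' where st': "0 < s'" "s' < h" "0 < t'" "t' < h"
      "g (x + h *\<^sub>R v + h *\<^sub>R u) - g (x + h *\<^sub>R v) - g (x + h *\<^sub>R u) + g x =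
        h * h * G v u (x + s' *\<^sub>R v + t' *\<^sub>R u)"
      using double_mean_value[OF g _ h, of x v u] d3(2) near(2) by (auto simp: G_def d_def)
    have "h * h * G u v (x + s *\<^sub>R u + t *\<^sub>R v) = h * h * G v u (x + s' *\<^sub>R v + t' *\<^sub>R u)"
      using st(5) st'(5) by (simp add: algebra_simps)
    then have eq: "G u v (x + s *\<^sub>R u + t *\<^sub>R v) = G v u (x + s' *\<^sub>R v + t' *\<^sub>R u)"
      using h by simp
    have "dist (G u v (x + s *\<^sub>R u + t *\<^sub>R v)) (G u v x) < e / 2"
      using d1(2) near(1)[of s t] st by (simp add: d_def)
    moreover have "dist (G v u (x + s' *\<^sub>R v + t' *\<^sub>R u)) (G v u x) < e / 2"
      using d2(2) near(2)[of s' t'] st' by (simp add: d_def)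
    ultimately show ?thesis
      using eq by (metis dist_commute dist_triangle_half_r)
  qed
  then have "G u v x = G v u x"
    by (metis dist_pos_lt less_irrefl)
  then show ?thesis
    by (simp add: G_def)
qed

lemma frechet_derivative_inner_left:
  assumes "f differentiable (at x)"
  shows "frechet_derivative (\<lambda>y. f y \<bullet> w) (at x) v = frechet_derivative f (at x) v \<bullet> w"
  using frechet_derivative_at[OF has_derivative_inner_left[OF assms[unfolded frechet_derivative_works]]]
  by metis

text \<open>The mean value theorem is tied to real values. Pairing with an arbitrary vector
  \<open>w\<close> commutes with both derivatives and reduces the claim to the real case.\<close>

lemma symmetric_second_derivative:
  fixes f :: "'e::real_normed_vector \<Rightarrow> 'f::real_inner"
  assumes f: "smooth_on f S" and S: "open S" "x \<in> S"
  shows "frechet_derivative (\<lambda>y. frechet_derivative f (at y) u) (at x) v =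
    frechet_derivative (\<lambda>y. frechet_derivative f (at y) v) (at x) u"
proof -
  have diff: "h differentiable (at y)" if "smooth_on h S" "y \<in> S" for h :: "'e \<Rightarrow> 'f" and y
    using smooth_on_has_derivative[OF that] by (auto simp: differentiable_def)
  have D: "frechet_derivative (\<lambda>y. frechet_derivative (\<lambda>z. f z \<bullet> w) (at y) u) (at x) v =
      frechet_derivative (\<lambda>y. frechet_derivative f (at y) u) (at x) v \<bullet> w" for u v w
  proof -
    have "((\<lambda>y. frechet_derivative f (at y) u \<bullet> w) has_derivative
        (\<lambda>v. frechet_derivative (\<lambda>y. frechet_derivative f (at y) u) (at x) v \<bullet> w)) (at x)"
      by (intro has_derivative_inner_left smooth_on_has_derivative[of _ S]
          smooth_on_frechet_derivative f S)
    then have "((\<lambda>y. frechet_derivative (\<lambda>z. f z \<bullet> w) (at y) u) has_derivative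
        (\<lambda>v. frechet_derivative (\<lambda>y. frechet_derivative f (at y) u) (at x) v \<bullet> w)) (at x)"
      using S diff[OF f]
      by (elim has_derivative_transform_within_open) (auto simp: frechet_derivative_inner_left)
    then show ?thesis
      using frechet_derivative_at by metis
  qed
  have "smooth_on (\<lambda>z. f z \<bullet> w) S" for w
    by (rule smooth_on_linear_compose[OF bounded_linear_inner_left S(1) f])
  from symmetric_second_derivative_real[OF this S]
  show ?thesis
    by (intro vector_eq_rdot[THEN iffD1]) (metis D)
qed

subsection \<open>The tangent map in coordinates\<close>

definition tangent_fun ::
  "('e::real_normed_vector \<Rightarrow> 'f::real_normed_vector) \<Rightarrow> 'e \<times> 'e \<Rightarrow> 'f \<times> 'f" where
  "tangent_fun f = (\<lambda>(x, v). (f x, frechet_derivative f (at x) v))"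

text \<open>This is the sigma of the overview, and \<open>tangent_fun\<close> is its
  \<open>T\<close>. On the coordinates of a tangent vector of a product the same map regroups two
  points followed by two vectors into two pairs of a point and a vector.\<close>

definition flip :: "('e \<times> 'e) \<times> ('e \<times> 'e) \<Rightarrow> ('e \<times> 'e) \<times> ('e \<times> 'e)" where
  "flip = (\<lambda>((q, v), (q', v')). ((q, q'), (v, v')))"

lemma flip_simp [simp]: "flip ((q, v), (q', v')) = ((q, q'), (v, v'))"
  by (simp add: flip_def)

lemma flip_flip [simp]: "flip (flip z) = z"
  by (cases z) (auto simp: flip_def split: prod.splits)

lemma flip_comp_flip [simp]: "flip \<circ> flip = id"
  by (auto simp: fun_eq_iff)

lemma bounded_linear_flip:
  "bounded_linear (flip :: ('e::real_normed_vector \<times> 'e) \<times> ('e \<times> 'e) \<Rightarrow> _)"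
proof -
  have "flip = (\<lambda>z :: ('e \<times> 'e) \<times> ('e \<times> 'e). ((fst (fst z), fst (snd z)), (snd (fst z), snd (snd z))))"
    by (auto simp: fun_eq_iff)
  moreover have "bounded_linear \<dots>"
    by (intro bounded_linear_Pair bounded_linear_fst_comp bounded_linear_snd_comp bounded_linear_fst bounded_linear_snd)
  ultimately show ?thesis by simp
qed

lemma open_flip_image:
  fixes S :: "(('e::real_normed_vector \<times> 'e) \<times> ('e \<times> 'e)) set"
  assumes "open S"
  shows "open (flip ` S)"
proof -
  have "flip ` S = flip -` S"
    by (metis (no_types, lifting) bij_vimage_eq_inv_image flip_comp_flip inv_unique_comp o_bij)
  then show ?thesis
    using assms bounded_linear_flip
    by (metis linear_continuous_on open_vimage)
qed

lemma tangent_fun_eq: "(f has_derivative f') (at x) \<Longrightarrow> tangent_fun f (x, v) = (f x, f' v)"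
  by (simp add: tangent_fun_def frechet_derivative_at[symmetric])

lemma tangent_fun_cong:
  assumes "open S" "x \<in> S" "\<And>y. y \<in> S \<Longrightarrow> f y = g y" "f differentiable (at x)"
  shows "tangent_fun f (x, v) = tangent_fun g (x, v)"
  using assms frechet_derivative_transform_within_open[OF assms(4,1,2,3)]
  by (simp add: tangent_fun_def)

text \<open>The direction is a variable here. Expanded in an orthogonal basis, the derivative is a
  finite sum of linear coordinates of \<open>snd z\<close> times derivatives of \<open>f\<close> in
  fixed directions, and each factor is smooth.\<close>

lemma smooth_on_tangent_fun:
  fixes f :: "'e::real_inner \<Rightarrow> 'f::real_normed_vector"
  assumes fd: "fin_dim TYPE('e)" and S: "open S" and f: "smooth_on f S"
  shows "smooth_on (tangent_fun f) (S \<times> UNIV)"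
proof -
  obtain B :: "'e set" where B: "finite B" "\<And>x. x = (\<Sum>b\<in>B. ((x \<bullet> b) / (b \<bullet> b)) *\<^sub>R b)"
    using fin_dim_expansion[OF fd] by metis
  have open': "open (S \<times> (UNIV :: 'e set))"
    using S by (simp add: open_Times)
  have fst': "smooth_on (\<lambda>z. g (fst z)) (S \<times> (UNIV :: 'e set))" if "smooth_on g S"
    for g :: "'e \<Rightarrow> 'f"
    by (rule smooth_on_compose[OF fd open' S _ smooth_on_bounded_linear[OF bounded_linear_fst open'] that])
      auto
  have "smooth_on (\<lambda>z. \<Sum>b\<in>B. ((snd z \<bullet> b) / (b \<bullet> b)) *\<^sub>R frechet_derivative f (at (fst z)) b)
      (S \<times> (UNIV :: 'e set))"
    unfolding smooth_on_def
  proof (intro allI Ck_on_sum Ck_on_scaleR open' B(1))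
    show "Ck_on k (\<lambda>z. frechet_derivative f (at (fst z)) b) (S \<times> (UNIV :: 'e set))" for k b
      using fst'[OF smooth_on_frechet_derivative[OF f], of b] by (auto simp: smooth_on_def)
    show "Ck_on k (\<lambda>z. (snd z \<bullet> b) / (b \<bullet> b)) (S \<times> UNIV)" for k and b :: 'e
      by (intro Ck_on_bounded_linear open' bounded_linear_compose[OF bounded_linear_coord]
          bounded_linear_snd)
  qed
  moreover have "(\<Sum>b\<in>B. ((snd z \<bullet> b) / (b \<bullet> b)) *\<^sub>R frechet_derivative f (at (fst z)) b) =
      frechet_derivative f (at (fst z)) (snd z)" if "z \<in> S \<times> (UNIV :: 'e set)" for z
    using that linear_expansion[OF has_derivative_linear[OF smooth_on_has_derivative[OF f]] B(2)]
    by (metis mem_Times_iff)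
  ultimately have "smooth_on (\<lambda>z. frechet_derivative f (at (fst z)) (snd z)) (S \<times> UNIV)"
    by (rule smooth_on_cong[OF open', rotated])
  from smooth_on_Pair[OF open' fst'[OF f] this]
  show ?thesis
    by (simp add: tangent_fun_def case_prod_beta')
qed

text \<open>The total derivative exists by smoothness of \<open>tangent_fun f\<close>, so by
  linearity it suffices to find it on \<open>(a, 0)\<close> and \<open>(0, b)\<close>. These values
  come from restricting \<open>tangent_fun f\<close> to the slices with fixed direction and with
  fixed base point.\<close>

lemma has_derivative_tangent_fun:
  fixes f :: "'e::real_inner \<Rightarrow> 'f::real_normed_vector"
  assumes fd: "fin_dim TYPE('e)" and S: "open S" "x \<in> S" and f: "smooth_on f S"
  shows "(tangent_fun f has_derivative (\<lambda>(a, b). (frechet_derivative f (at x) a,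
      frechet_derivative (\<lambda>y. frechet_derivative f (at y) v) (at x) a + frechet_derivative f (at x) b)))
    (at (x, v))"
proof -
  let ?L = "frechet_derivative (tangent_fun f) (at (x, v))"
  have L: "(tangent_fun f has_derivative ?L) (at (x, v))"
    using S by (intro smooth_on_has_derivative[OF smooth_on_tangent_fun[OF fd S(1) f]]) auto
  have fx: "(f has_derivative frechet_derivative f (at x)) (at x)"
    using smooth_on_has_derivative[OF f S(2)] .
  have "((\<lambda>y. (y, v)) has_derivative (\<lambda>a. (a, 0))) (at x)"
    by (auto intro!: derivative_eq_intros)
  from has_derivative_compose[OF this L]
  have 1: "((\<lambda>y. (f y, frechet_derivative f (at y) v)) has_derivative (\<lambda>a. ?L (a, 0))) (at x)"
    by (simp add: tangent_fun_def)
  have "((\<lambda>y. (f y, frechet_derivative f (at y) v)) has_derivative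
      (\<lambda>a. (frechet_derivative f (at x) a,
        frechet_derivative (\<lambda>y. frechet_derivative f (at y) v) (at x) a))) (at x)"
    by (intro has_derivative_Pair fx smooth_on_has_derivative[OF _ S(2)] smooth_on_frechet_derivative f)
  from has_derivative_unique[OF 1 this]
  have 1: "?L (a, 0) = (frechet_derivative f (at x) a,
      frechet_derivative (\<lambda>y. frechet_derivative f (at y) v) (at x) a)" for a
    by metis
  have "((\<lambda>w. (x, w)) has_derivative (\<lambda>b. (0, b))) (at v)"
    by (auto intro!: derivative_eq_intros)
  from has_derivative_compose[OF this L]
  have 2: "((\<lambda>w. (f x, frechet_derivative f (at x) w)) has_derivative (\<lambda>b. ?L (0, b))) (at v)"
    by (simp add: tangent_fun_def)
  have "((\<lambda>w. (f x, frechet_derivative f (at x) w)) has_derivative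
      (\<lambda>b. (0, frechet_derivative f (at x) b))) (at v)"
    by (intro has_derivative_Pair has_derivative_const
        bounded_linear_imp_has_derivative has_derivative_bounded_linear[OF fx])
  from has_derivative_unique[OF 2 this]
  have 2: "?L (0, b) = (0, frechet_derivative f (at x) b)" for b
    by metis
  have "?L (a, b) = ?L (a, 0) + ?L (0, b)" for a b
    using linear_add[OF has_derivative_linear[OF L], of "(a, 0)" "(0, b)"] by simp
  then have "?L = (\<lambda>(a, b). (frechet_derivative f (at x) a,
      frechet_derivative (\<lambda>y. frechet_derivative f (at y) v) (at x) a + frechet_derivative f (at x) b))"
    using 1 2 by (auto simp: fun_eq_iff)
  then show ?thesis using L by simp
qed

text \<open>At \<open>((x, v), (a, b))\<close> the iterated tangent map has the components
  \<open>f x\<close>, \<open>D f v\<close>, \<open>D f a\<close> and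
  \<open>D\<^sup>2 f (v, a) + D f b\<close>, derivatives being taken at \<open>x\<close>. Exchanging
  \<open>v\<close> and \<open>a\<close> swaps the two middle ones and, by symmetry, preserves the
  last.\<close>

lemma tangent_fun_tangent_fun_flip:
  fixes f :: "'e::real_inner \<Rightarrow> 'f::real_inner"
  assumes fd: "fin_dim TYPE('e)" and S: "open S" "fst (fst z) \<in> S" and f: "smooth_on f S"
  shows "tangent_fun (tangent_fun f) (flip z) = flip (tangent_fun (tangent_fun f) z)"
proof -
  obtain x v a b where z: "z = ((x, v), (a, b))" by (metis surj_pair)
  have x: "x \<in> S" using S z by simp
  show ?thesis
    using symmetric_second_derivative[OF f S(1) x, of v a]
    by (simp add: z tangent_fun_eq[OF has_derivative_tangent_fun[OF fd S(1) x f]])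
       (simp add: tangent_fun_def)
qed

text \<open>The mixed second derivative occurring here vanishes: by symmetry it is the derivative along
  \<open>v\<close> of the constant \<open>y \<mapsto> D s (y, 0) (0, a) = a\<close>.\<close>

lemma frechet_derivative_tangent_fun_flip:
  fixes s :: "'e::real_inner \<times> 'e \<Rightarrow> 'e"
  assumes fd: "fin_dim TYPE('e)" and S: "open S" and s: "smooth_on s S"
    and A: "open A" "q \<in> A" "\<And>y. y \<in> A \<Longrightarrow> (y, 0) \<in> S"
    and id: "\<And>y e. y \<in> A \<Longrightarrow> frechet_derivative s (at (y, 0)) (0, e) = e"
  shows "((tangent_fun s \<circ> flip) has_derivative
      frechet_derivative (tangent_fun s \<circ> flip) (at ((q, v), (0, 0)))) (at ((q, v), (0, 0)))"
    and "frechet_derivative (tangent_fun s \<circ> flip) (at ((q, v), (0, 0))) (0, (a, b)) = (a, b)"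
proof -
  let ?D = "\<lambda>w. frechet_derivative (\<lambda>z. frechet_derivative s (at z) w) (at (q, 0))"
  have q: "(q, 0) \<in> S" using A by simp
  \<comment> \<open>The point \<open>((q, v), (0, 0))\<close> is flipped to
    \<open>((q, 0), (v, 0))\<close>: a base point on the zero section with a direction tangent to
    it.\<close>
  note ht = has_derivative_tangent_fun[OF fin_dim_prod[OF fd fd] S q s, of "(v, 0)"]
  have "(flip has_derivative flip) (at ((q, v), (0::'e, 0::'e)))"
    by (rule bounded_linear_imp_has_derivative[OF bounded_linear_flip])
  from diff_chain_at[OF this, unfolded flip_simp, OF ht]
  have *: "((tangent_fun s \<circ> flip) has_derivative (\<lambda>z. (\<lambda>(a, b). (frechet_derivative s (at (q, 0)) a,
      ?D (v, 0) a + frechet_derivative s (at (q, 0)) b)) (flip z))) (at ((q, v), (0, 0)))"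
    by (simp add: o_def)
  then show "((tangent_fun s \<circ> flip) has_derivative
      frechet_derivative (tangent_fun s \<circ> flip) (at ((q, v), (0, 0)))) (at ((q, v), (0, 0)))"
    unfolding frechet_derivative_works[symmetric] by (rule differentiableI)
  have "((\<lambda>y. (y, 0::'e)) has_derivative (\<lambda>r. (r, 0))) (at q)"
    by (auto intro!: derivative_eq_intros)
  from has_derivative_compose[OF this
      smooth_on_has_derivative[OF smooth_on_frechet_derivative[OF s] q]]
  have "((\<lambda>y. frechet_derivative s (at (y, 0)) (0, a)) has_derivative (\<lambda>r. ?D (0, a) (r, 0))) (at q)" .
  moreover have "((\<lambda>y. frechet_derivative s (at (y, 0)) (0, a)) has_derivative (\<lambda>r. 0)) (at q)"
    by (rule has_derivative_transform_within_open[OF has_derivative_const A(1,2)]) (simp add: id)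
  ultimately have "?D (0, a) (v, 0) = 0"
    using has_derivative_unique by metis
  then have "?D (v, 0) (0, a) = 0"
    using symmetric_second_derivative[OF s S q] by metis
  \<comment> \<open>The fibre direction \<open>(0, (a, b))\<close> is flipped to
    \<open>((0, a), (0, b))\<close>, so both first-order terms are derivatives of \<open>s\<close>
    along the fibre, given by \<open>id\<close>.\<close>
  then show "frechet_derivative (tangent_fun s \<circ> flip) (at ((q, v), (0, 0))) (0, (a, b)) = (a, b)"
    using frechet_derivative_at[OF *, symmetric] id[OF A(2)] flip_simp[of 0 0 a b, folded zero_prod_def]
    by simp
qed

section \<open>Charts and the tangent bundle\<close>

abbreviation transition :: "('a, 'e) chart \<Rightarrow> ('a, 'f) chart \<Rightarrow> 'e \<Rightarrow> 'f" where
  "transition c d \<equiv> chart_map d \<circ> chart_inv c"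

abbreviation coord_map :: "('a, 'e) chart \<Rightarrow> ('b, 'f) chart \<Rightarrow> ('a \<Rightarrow> 'b) \<Rightarrow> 'e \<Rightarrow> 'f" where
  "coord_map c d f \<equiv> chart_map d \<circ> f \<circ> chart_inv c"

lemma chart_inv_map: "smooth_atlas M \<Longrightarrow> c \<in> M \<Longrightarrow> p \<in> chart_dom c \<Longrightarrow> chart_inv c (chart_map c p) = p"
  by (simp add: chart_inv_def smooth_atlas_def)

lemma open_chart_image: "smooth_atlas M \<Longrightarrow> c \<in> M \<Longrightarrow> open (chart_map c ` chart_dom c)"
  by (simp add: smooth_atlas_def)

lemma open_chart_overlap:
  "smooth_atlas M \<Longrightarrow> c \<in> M \<Longrightarrow> d \<in> M \<Longrightarrow> open (chart_map c ` (chart_dom c \<inter> chart_dom d))"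
  by (simp add: smooth_atlas_def)

lemma smooth_on_transition:
  "smooth_atlas M \<Longrightarrow> c \<in> M \<Longrightarrow> d \<in> M \<Longrightarrow>
    smooth_on (transition c d) (chart_map c ` (chart_dom c \<inter> chart_dom d))"
  by (simp add: smooth_atlas_def)

lemma topspace_atlas_topology:
  assumes M: "smooth_atlas M"
  shows "topspace (atlas_topology M) = carrier M"
proof -
  have "openin (atlas_topology M) (carrier M)"
  proof -
    have "carrier M \<inter> chart_dom c = chart_dom c" if "c \<in> M" for c
      using that by (auto simp: carrier_def)
    then show ?thesis
      using M by (simp add: openin_atlas_topology open_chart_image)
  qed
  then show ?thesis
    by (metis M openin_atlas_topology openin_subset openin_topspace subset_antisym)
qed

text \<open>Within one chart domain a single chart decides openness: the image of \<open>W\<close>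
  in another chart \<open>d\<close> is the preimage of its image in \<open>c\<close> under a
  continuous transition map.\<close>

lemma openin_chart_iff:
  assumes M: "smooth_atlas M" and c: "c \<in> M" and W: "W \<subseteq> chart_dom c"
  shows "openin (atlas_topology M) W \<longleftrightarrow> open (chart_map c ` W)"
proof
  assume "openin (atlas_topology M) W"
  then have "open (chart_map c ` (W \<inter> chart_dom c))"
    using M c by (simp add: openin_atlas_topology)
  then show "open (chart_map c ` W)"
    using W by (simp add: Int_absorb2)
next
  assume o: "open (chart_map c ` W)"
  have "open (chart_map d ` (W \<inter> chart_dom d))" if d: "d \<in> M" for d
  proof -
    let ?A = "chart_map d ` (chart_dom d \<inter> chart_dom c)"
    have "chart_map d ` (W \<inter> chart_dom d) = ?A \<inter> transition d c -` (chart_map c ` W)"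
    proof (intro subset_antisym subsetI)
      fix y assume "y \<in> chart_map d ` (W \<inter> chart_dom d)"
      then show "y \<in> ?A \<inter> transition d c -` (chart_map c ` W)"
        using W by (auto simp: chart_inv_map[OF M d])
    next
      fix y assume "y \<in> ?A \<inter> transition d c -` (chart_map c ` W)"
      then obtain p q where p: "p \<in> chart_dom d" "p \<in> chart_dom c" "y = chart_map d p"
        and q: "q \<in> W" "chart_map c p = chart_map c q"
        by (auto simp: chart_inv_map[OF M d])
      have "p = q"
        using chart_inv_map[OF M c] p q W by (metis subsetD)
      then show "y \<in> chart_map d ` (W \<inter> chart_dom d)"
        using p q by auto
    qed
    then show ?thesis
      using continuous_open_preimage[OF smooth_on_continuous_on[OF smooth_on_transition[OF M d c]]
          open_chart_overlap[OF M d c] o] by simp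
  qed
  then show "openin (atlas_topology M) W"
    using M c W by (auto simp: openin_atlas_topology carrier_def)
qed

lemma openin_chart_dom: "smooth_atlas M \<Longrightarrow> c \<in> M \<Longrightarrow> openin (atlas_topology M) (chart_dom c)"
  by (simp add: openin_chart_iff open_chart_image)

lemma openin_chart_preimage:
  assumes "smooth_atlas M" "c \<in> M" "open A"
  shows "openin (atlas_topology M) {p \<in> chart_dom c. chart_map c p \<in> A}"
proof -
  have "chart_map c ` {p \<in> chart_dom c. chart_map c p \<in> A} = chart_map c ` chart_dom c \<inter> A"
    by auto
  then show ?thesis
    using assms by (subst openin_chart_iff[of M c]) (auto intro!: open_chart_image)
qed

lemma open_image_openin:
  "smooth_atlas M \<Longrightarrow> c \<in> M \<Longrightarrow> openin (atlas_topology M) W \<Longrightarrow> W \<subseteq> chart_dom c \<Longrightarrow>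
    open (chart_map c ` W)"
  by (simp add: openin_chart_iff)

section \<open>Derivatives of transition maps and components of tangent vectors\<close>

lemma has_derivative_transition:
  assumes "smooth_atlas M" "c \<in> M" "d \<in> M" "p \<in> chart_dom c" "p \<in> chart_dom d"
  shows "(transition c d has_derivative frechet_derivative (transition c d) (at (chart_map c p)))
    (at (chart_map c p))"
  using assms by (intro smooth_on_has_derivative[OF smooth_on_transition[of M]]) auto

lemma frechet_derivative_transition_self:
  assumes M: "smooth_atlas M" and c: "c \<in> M" "p \<in> chart_dom c"
  shows "frechet_derivative (transition c c) (at (chart_map c p)) = id"
proof -
  have "(transition c c has_derivative id) (at (chart_map c p))"
    by (rule has_derivative_transform_within_open[OF has_derivative_id open_chart_image[OF M c(1)]])
      (use c in \<open>auto simp: chart_inv_map[OF M]\<close>)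
  then show ?thesis
    by (rule frechet_derivative_at[symmetric])
qed

text \<open>Near the point the transition from \<open>c\<close> to \<open>e\<close> factors through
  \<open>d\<close>, so this is the chain rule. It is the cocycle identity that makes components in
  different charts compatible.\<close>

lemma frechet_derivative_transition_compose:
  assumes M: "smooth_atlas M" and cde: "c \<in> M" "d \<in> M" "e \<in> M"
    and p: "p \<in> chart_dom c" "p \<in> chart_dom d" "p \<in> chart_dom e"
  shows "frechet_derivative (transition c e) (at (chart_map c p)) v =
    frechet_derivative (transition d e) (at (chart_map d p))
      (frechet_derivative (transition c d) (at (chart_map c p)) v)"
proof -
  note cd = has_derivative_transition[OF M cde(1,2) p(1,2)]
  note de = has_derivative_transition[OF M cde(2,3) p(2,3)]
  have "((\<lambda>y. transition d e (transition c d y)) has_derivative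
      (\<lambda>v. frechet_derivative (transition d e) (at (chart_map d p))
        (frechet_derivative (transition c d) (at (chart_map c p)) v))) (at (chart_map c p))"
    using has_derivative_compose[OF cd, of "transition d e"] de
    by (simp add: chart_inv_map[OF M cde(1) p(1)] o_def)
  then have "(transition c e has_derivative
      (\<lambda>v. frechet_derivative (transition d e) (at (chart_map d p))
        (frechet_derivative (transition c d) (at (chart_map c p)) v))) (at (chart_map c p))"
    by (rule has_derivative_transform_within_open[OF _ open_chart_overlap[OF M cde(1,2)]])
      (use p cde in \<open>auto simp: chart_inv_map[OF M]\<close>)
  from fun_cong[OF frechet_derivative_at[OF this, symmetric], of v] show ?thesis .
qed

text \<open>Inverse of taking components in \<open>c\<close>: the vector at \<open>p\<close> whose
  component there is \<open>e\<close>. The value 0 elsewhere is dictated by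
  \<open>tangent_space\<close>.\<close>

definition tangent_vector ::
  "('a, 'e::real_inner) atlas \<Rightarrow> 'a \<Rightarrow> ('a, 'e) chart \<Rightarrow> 'e \<Rightarrow> ('a, 'e) chart \<Rightarrow> 'e" where
  "tangent_vector M p c e = (\<lambda>d. if d \<in> M \<and> p \<in> chart_dom d
     then frechet_derivative (transition c d) (at (chart_map c p)) e else 0)"

lemma tangent_vector_in_tangent_space:
  assumes "smooth_atlas M" "c \<in> M" "p \<in> chart_dom c"
  shows "tangent_vector M p c e \<in> tangent_space M p"
  using assms by (auto simp: tangent_space_def tangent_vector_def
      intro: frechet_derivative_transition_compose)

lemma tangent_vector_at:
  assumes "smooth_atlas M" "c \<in> M" "p \<in> chart_dom c"
  shows "tangent_vector M p c e c = e"
  using assms by (simp add: tangent_vector_def frechet_derivative_transition_self)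

lemma tangent_space_transition:
  assumes "v \<in> tangent_space M p" "c \<in> M" "d \<in> M" "p \<in> chart_dom c" "p \<in> chart_dom d"
  shows "v d = frechet_derivative (transition c d) (at (chart_map c p)) (v c)"
  using assms unfolding tangent_space_def by blast

lemma tangent_space_outside:
  "v \<in> tangent_space M p \<Longrightarrow> c \<notin> M \<or> p \<notin> chart_dom c \<Longrightarrow> v c = 0"
  unfolding tangent_space_def by blast

lemma tangent_space_eqI:
  assumes "v \<in> tangent_space M p" "w \<in> tangent_space M p" "c \<in> M" "p \<in> chart_dom c" "v c = w c"
  shows "v = w"
proof
  show "v d = w d" for d
    using tangent_space_transition[OF assms(1) assms(3) _ assms(4)]
      tangent_space_transition[OF assms(2) assms(3) _ assms(4)]
      tangent_space_outside[OF assms(1)] tangent_space_outside[OF assms(2)] assms(5)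
    by metis
qed

lemma zero_in_tangent_space:
  assumes "smooth_atlas M"
  shows "(\<lambda>c. 0) \<in> tangent_space M p"
  using has_derivative_transition[OF assms] by (auto simp: tangent_space_def dest!: linear_0[OF has_derivative_linear])

section \<open>The atlas of the tangent bundle\<close>

lemma chart_dom_tangent_chart [simp]:
  "chart_dom (tangent_chart M c) = Sigma (chart_dom c) (tangent_space M)"
  by (simp add: tangent_chart_def)

lemma chart_map_tangent_chart [simp]:
  "chart_map (tangent_chart M c) (p, v) = (chart_map c p, v c)"
  by (simp add: tangent_chart_def)

lemma tangent_chart_in: "c \<in> M \<Longrightarrow> tangent_chart M c \<in> tangent_bundle M"
  by (simp add: tangent_bundle_def)

lemma tangent_chart_image:
  assumes M: "smooth_atlas M" and c: "c \<in> M" and W: "W \<subseteq> chart_dom c"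
  shows "chart_map (tangent_chart M c) ` tangent_over M W = (chart_map c ` W) \<times> UNIV"
proof (intro subset_antisym subsetI)
  fix z assume "z \<in> (chart_map c ` W) \<times> (UNIV :: 'b set)"
  then obtain p e where z: "p \<in> W" "z = (chart_map c p, e)" by auto
  then have "p \<in> chart_dom c" using W by auto
  then have "(p, tangent_vector M p c e) \<in> tangent_over M W"
    "z = chart_map (tangent_chart M c) (p, tangent_vector M p c e)"
    using z M c by (auto simp: tangent_over_def tangent_vector_in_tangent_space tangent_vector_at)
  then show "z \<in> chart_map (tangent_chart M c) ` tangent_over M W"
    by blast
qed (auto simp: tangent_over_def)

lemma inj_on_tangent_chart:
  assumes "smooth_atlas M" "c \<in> M"
  shows "inj_on (chart_map (tangent_chart M c)) (chart_dom (tangent_chart M c))"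
proof (rule inj_onI)
  fix z z' assume z: "z \<in> chart_dom (tangent_chart M c)" "z' \<in> chart_dom (tangent_chart M c)"
    "chart_map (tangent_chart M c) z = chart_map (tangent_chart M c) z'"
  then have "fst z = fst z'"
    using chart_inv_map[OF assms] by (auto, metis)
  then show "z = z'"
    using z assms(2) by (auto intro!: tangent_space_eqI[of _ M "fst z"])
qed

lemma chart_inv_tangent_chart:
  assumes M: "smooth_atlas M" and c: "c \<in> M" "p \<in> chart_dom c"
  shows "chart_inv (tangent_chart M c) (chart_map c p, e) = (p, tangent_vector M p c e)"
proof -
  have "(chart_map c p, e) = chart_map (tangent_chart M c) (p, tangent_vector M p c e)"
    using assms by (simp add: tangent_vector_at)
  moreover have "(p, tangent_vector M p c e) \<in> chart_dom (tangent_chart M c)"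
    using assms by (simp add: tangent_vector_in_tangent_space)
  ultimately show ?thesis
    unfolding chart_inv_def by (metis inv_into_f_f inj_on_tangent_chart[OF M c(1)])
qed

lemma transition_tangent_chart:
  assumes M: "smooth_atlas M" and c: "c \<in> M" "d \<in> M"
    and y: "y \<in> chart_map c ` (chart_dom c \<inter> chart_dom d)"
  shows "transition (tangent_chart M c) (tangent_chart M d) (y, e) = tangent_fun (transition c d) (y, e)"
proof -
  obtain p where p: "p \<in> chart_dom c" "p \<in> chart_dom d" "y = chart_map c p"
    using y by auto
  then show ?thesis
    using M c by (simp add: chart_inv_tangent_chart tangent_fun_def chart_inv_map tangent_vector_def)
qed

lemma tangent_chart_overlap:
  "chart_dom (tangent_chart M c) \<inter> chart_dom (tangent_chart M d) =
    tangent_over M (chart_dom c \<inter> chart_dom d)"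
  by (auto simp: tangent_over_def)

text \<open>Overlaps of tangent charts are cylinders over the overlaps in the base, and there the
  transition maps are \<open>tangent_fun\<close> of those in the base.\<close>

lemma smooth_atlas_tangent_bundle:
  fixes M :: "('a, 'e::real_inner) atlas"
  assumes fd: "fin_dim TYPE('e)" and M: "smooth_atlas M"
  shows "smooth_atlas (tangent_bundle M)"
proof -
  have *: "open (chart_map C ` (chart_dom C \<inter> chart_dom D)) \<and>
      smooth_on (transition C D) (chart_map C ` (chart_dom C \<inter> chart_dom D))"
    if C: "C \<in> tangent_bundle M" "D \<in> tangent_bundle M" for C D
  proof -
    obtain c d where cd: "c \<in> M" "d \<in> M" "C = tangent_chart M c" "D = tangent_chart M d"
      using C by (auto simp: tangent_bundle_def)
    have im: "chart_map C ` (chart_dom C \<inter> chart_dom D) =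
        (chart_map c ` (chart_dom c \<inter> chart_dom d)) \<times> UNIV"
      unfolding cd tangent_chart_overlap by (rule tangent_chart_image[OF M cd(1)]) simp
    have o: "open ((chart_map c ` (chart_dom c \<inter> chart_dom d)) \<times> (UNIV :: 'e set))"
      by (intro open_Times open_chart_overlap[OF M cd(1,2)] open_UNIV)
    have "smooth_on (transition C D) ((chart_map c ` (chart_dom c \<inter> chart_dom d)) \<times> UNIV)"
      by (rule smooth_on_cong[OF o _ smooth_on_tangent_fun[OF fd open_chart_overlap smooth_on_transition]])
        (use cd transition_tangent_chart[OF M cd(1,2)] M in auto)
    then show ?thesis
      using o im by simp
  qed
  moreover have "inj_on (chart_map C) (chart_dom C)" if "C \<in> tangent_bundle M" for C
    using that inj_on_tangent_chart[OF M] by (auto simp: tangent_bundle_def)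
  \<comment> \<open>That a chart has open image is the overlap condition for the chart with
    itself.\<close>
  ultimately show ?thesis
    unfolding smooth_atlas_def by (metis Int_absorb)
qed

section \<open>The topology of the tangent bundle\<close>

lemma carrier_tangent_bundle: "carrier (tangent_bundle M) = tangent_over M (carrier M)"
  by (auto simp: carrier_def tangent_bundle_def tangent_over_def)

lemma tangent_bundle_obtain_chart:
  assumes "z \<in> carrier (tangent_bundle M)"
  obtains c where "c \<in> M" "fst z \<in> chart_dom c" "z \<in> chart_dom (tangent_chart M c)"
  using assms by (auto simp: carrier_def tangent_bundle_def)

lemma openin_tangent_over:
  fixes M :: "('a, 'e::real_inner) atlas"
  assumes fd: "fin_dim TYPE('e)" and M: "smooth_atlas M" and W: "openin (atlas_topology M) W"
  shows "openin (atlas_topology (tangent_bundle M)) (tangent_over M W)"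
proof -
  have "tangent_over M W \<subseteq> carrier (tangent_bundle M)"
    using W M by (auto simp: carrier_tangent_bundle tangent_over_def openin_atlas_topology)
  moreover have "open (chart_map C ` (tangent_over M W \<inter> chart_dom C))" if C: "C \<in> tangent_bundle M" for C
  proof -
    obtain c where c: "c \<in> M" "C = tangent_chart M c"
      using C by (auto simp: tangent_bundle_def)
    have "tangent_over M W \<inter> chart_dom C = tangent_over M (W \<inter> chart_dom c)"
      by (auto simp: tangent_over_def c)
    then have "chart_map C ` (tangent_over M W \<inter> chart_dom C) = chart_map c ` (W \<inter> chart_dom c) \<times> UNIV"
      using tangent_chart_image[OF M c(1), of "W \<inter> chart_dom c"] by (simp add: c)
    then show ?thesis
      using W M c(1) by (simp add: openin_atlas_topology open_Times)
  qed
  ultimately show ?thesis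
    by (simp add: openin_atlas_topology[OF smooth_atlas_tangent_bundle[OF fd M]])
qed

text \<open>Vectors over different points are separated by preimages of sets that separate the
  points. Vectors over the same point lie in a common tangent chart and are separated there by their
  coordinates.\<close>

lemma Hausdorff_tangent_bundle:
  fixes M :: "('a, 'e::real_inner) atlas"
  assumes fd: "fin_dim TYPE('e)" and M: "smooth_atlas M" and H: "Hausdorff_space (atlas_topology M)"
  shows "Hausdorff_space (atlas_topology (tangent_bundle M))"
  unfolding Hausdorff_space_def
proof (intro allI impI, elim conjE)
  let ?T = "atlas_topology (tangent_bundle M)"
  note TM = smooth_atlas_tangent_bundle[OF fd M]
  fix z w assume "z \<in> topspace ?T" "w \<in> topspace ?T" and ne: "z \<noteq> w"
  then have zw: "z \<in> tangent_over M (carrier M)" "w \<in> tangent_over M (carrier M)"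
    by (simp_all add: topspace_atlas_topology[OF TM] carrier_tangent_bundle)
  show "\<exists>U V. openin ?T U \<and> openin ?T V \<and> z \<in> U \<and> w \<in> V \<and> disjnt U V"
  proof (cases "fst z = fst w")
    case False
    have "fst z \<in> topspace (atlas_topology M)" "fst w \<in> topspace (atlas_topology M)"
      using zw by (auto simp: topspace_atlas_topology[OF M] tangent_over_def)
    then obtain U V where UV: "openin (atlas_topology M) U" "openin (atlas_topology M) V"
      "fst z \<in> U" "fst w \<in> V" "disjnt U V"
      using H False unfolding Hausdorff_space_def by metis
    show ?thesis
      by (rule exI[of _ "tangent_over M U"], rule exI[of _ "tangent_over M V"])
        (use UV zw openin_tangent_over[OF fd M] in \<open>auto simp: tangent_over_def disjnt_def\<close>)
  next
    case True
    obtain c where c: "c \<in> M" "z \<in> chart_dom (tangent_chart M c)"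
      using zw(1) tangent_bundle_obtain_chart by (metis carrier_tangent_bundle)
    let ?C = "tangent_chart M c"
    have w: "w \<in> chart_dom ?C"
      using c True zw(2) by (auto simp: tangent_over_def)
    have "chart_map ?C z \<noteq> chart_map ?C w"
      using inj_on_tangent_chart[OF M c(1)] c(2) w ne by (meson inj_onD)
    then obtain A B where AB: "open A" "open B" "chart_map ?C z \<in> A" "chart_map ?C w \<in> B" "A \<inter> B = {}"
      by (metis separation_t2)
    show ?thesis
      by (rule exI[of _ "{x \<in> chart_dom ?C. chart_map ?C x \<in> A}"],
          rule exI[of _ "{x \<in> chart_dom ?C. chart_map ?C x \<in> B}"], intro conjI
          openin_chart_preimage[OF TM tangent_chart_in[OF c(1)]])
        (use c w AB in \<open>auto simp: disjnt_def\<close>)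
  qed
qed

text \<open>Induction over a spanning set: a new vector \<open>b\<close> contributes its rational
  multiples, added to a countable set approximating the span of the previous vectors.\<close>

lemma fin_dim_countable_dense:
  assumes "fin_dim TYPE('e::real_inner)"
  obtains D :: "'e::real_inner set" where "countable D" "\<And>x e. 0 < e \<Longrightarrow> \<exists>d\<in>D. dist x d < e"
proof -
  obtain B :: "'e set" where B: "finite B" "span B = UNIV"
    using assms by (auto simp: fin_dim_def)
  have "\<exists>D. countable D \<and> (\<forall>x\<in>span B. \<forall>e>0. \<exists>d\<in>D. dist x d < e)"
    using B(1)
  proof (induction B rule: finite_induct)
    case empty
    then show ?case by (intro exI[of _ "{0}"]) auto
  next
    case (insert b B)
    then obtain D where D: "countable D" "\<And>x e. x \<in> span B \<Longrightarrow> 0 < e \<Longrightarrow> \<exists>d\<in>D. dist x d < e"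
      by metis
    let ?D = "(\<lambda>(q, d). q *\<^sub>R b + d) ` (\<rat> \<times> D)"
    have "\<exists>d\<in>?D. dist x d < e" if x: "x \<in> span (insert b B)" and e: "0 < e" for x e
    proof -
      obtain k where k: "x - k *\<^sub>R b \<in> span B"
        using x by (auto simp: span_insert)
      obtain d where d: "d \<in> D" "dist (x - k *\<^sub>R b) d < e / 2"
        using D(2)[OF k, of "e / 2"] e by auto
      \<comment> \<open>The bound gives \<open>b\<close> an error of at most \<open>e / 2\<close>;
        the summand 1 in the denominator covers the case that \<open>b\<close> is zero.\<close>
      obtain q where q: "q \<in> \<rat>" "k < q" "q < k + e / (2 * (norm b + 1))"
        using Rats_dense_in_real[of k "k + e / (2 * (norm b + 1))"] e
        by (auto simp: add_nonneg_pos)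
      have "dist x (q *\<^sub>R b + d) = norm ((x - k *\<^sub>R b - d) + (k - q) *\<^sub>R b)"
        by (simp add: dist_norm algebra_simps)
      also have "\<dots> \<le> norm (x - k *\<^sub>R b - d) + \<bar>k - q\<bar> * norm b"
        by (metis norm_scaleR norm_triangle_ineq)
      also have "\<dots> < e / 2 + e / 2"
      proof (rule add_less_le_mono)
        show "norm (x - k *\<^sub>R b - d) < e / 2"
          using d by (simp add: dist_norm)
        have "\<bar>k - q\<bar> * norm b \<le> (e / (2 * (norm b + 1))) * (norm b + 1)"
          using q e by (intro mult_mono) auto
        also have "\<dots> = e / 2"
        proof -
          have "norm b + 1 \<noteq> 0"
            using norm_ge_zero[of b] by argo
          moreover have "e / (2 * c) * c = e / 2" if "c \<noteq> 0" for c
            using that by simp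
          ultimately show ?thesis by blast
        qed
        finally show "\<bar>k - q\<bar> * norm b \<le> e / 2" .
      qed
      finally have "dist x (q *\<^sub>R b + d) < e" by simp
      then show ?thesis using q(1) d(1) by force
    qed
    moreover have "countable ?D"
      using D(1) by (intro countable_image countable_SIGMA countable_rat)
    ultimately show ?case by blast
  qed
  then show ?thesis
    using that B(2) by auto
qed

text \<open>A base of the tangent bundle is given by \<open>{(p, v). p \<in> V, v c \<in> ball e (1/n)}\<close> where \<open>V\<close> runs through
  a countable base of the manifold, \<open>c\<close> through charts selected for the members of this base,
  and \<open>e\<close> through a countable dense subset of the model space.\<close>

lemma second_countable_tangent_bundle:
  fixes M :: "('a, 'e::real_inner) atlas"
  assumes fd: "fin_dim TYPE('e)" and M: "smooth_atlas M" and S: "second_countable (atlas_topology M)"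
  shows "second_countable (atlas_topology (tangent_bundle M))"
proof -
  let ?T = "atlas_topology (tangent_bundle M)"
  note TM = smooth_atlas_tangent_bundle[OF fd M]
  obtain \<B> where \<B>: "countable \<B>" "\<And>V. V \<in> \<B> \<Longrightarrow> openin (atlas_topology M) V"
    "\<And>U x. openin (atlas_topology M) U \<Longrightarrow> x \<in> U \<Longrightarrow> \<exists>V\<in>\<B>. x \<in> V \<and> V \<subseteq> U"
    using S unfolding second_countable_def by metis
  obtain D :: "'e set" where D: "countable D" "\<And>x e. 0 < e \<Longrightarrow> \<exists>d\<in>D. dist x d < e"
    using fin_dim_countable_dense[OF fd] by metis
  define \<B>' where "\<B>' = {V \<in> \<B>. \<exists>c\<in>M. V \<subseteq> chart_dom c}"
  \<comment> \<open>The atlas may be uncountable; one chart for each member of \<open>\<B>'\<close>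
    leaves only countably many in use.\<close>
  define ch where "ch V = (SOME c. c \<in> M \<and> V \<subseteq> chart_dom c)" for V
  have ch: "ch V \<in> M" "V \<subseteq> chart_dom (ch V)" if "V \<in> \<B>'" for V
    using someI_ex[of "\<lambda>c. c \<in> M \<and> V \<subseteq> chart_dom c"] that by (auto simp: \<B>'_def ch_def)
  define N where "N = (\<lambda>(V0, V, e, n). {z \<in> chart_dom (tangent_chart M (ch V0)).
      chart_map (tangent_chart M (ch V0)) z \<in>
        chart_map (ch V0) ` (V \<inter> chart_dom (ch V0)) \<times> ball e (inverse (real (Suc n)))})"
  let ?I = "\<B>' \<times> \<B> \<times> D \<times> (UNIV :: nat set)"
  have "countable (N ` ?I)"
    using \<B>(1) D(1) by (intro countable_image countable_SIGMA) (auto simp: \<B>'_def intro: countable_subset)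
  moreover have "openin ?T X" if "X \<in> N ` ?I" for X
    using that ch \<B>(2) M unfolding N_def
    by (auto intro!: openin_chart_preimage[OF TM tangent_chart_in] open_Times
        simp: openin_atlas_topology simp del: chart_dom_tangent_chart)
  moreover have "\<exists>X\<in>N ` ?I. z \<in> X \<and> X \<subseteq> W" if W: "openin ?T W" "z \<in> W" for W z
  proof -
    have "z \<in> carrier (tangent_bundle M)"
      using W by (auto simp: openin_atlas_topology[OF TM])
    then obtain c0 where c0: "c0 \<in> M" "fst z \<in> chart_dom c0" "z \<in> chart_dom (tangent_chart M c0)"
      by (rule tangent_bundle_obtain_chart)
    obtain V0 where V0: "V0 \<in> \<B>" "fst z \<in> V0" "V0 \<subseteq> chart_dom c0"
      using \<B>(3)[OF openin_chart_dom[OF M c0(1)] c0(2)] by auto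
    then have V0': "V0 \<in> \<B>'" using c0(1) by (auto simp: \<B>'_def)
    \<comment> \<open>The selected chart may differ from \<open>c0\<close>, which only served to
      find \<open>V0\<close>; its domain contains \<open>V0\<close> and hence the base point of
      \<open>z\<close>.\<close>
    define c where "c = ch V0"
    define C where "C = tangent_chart M c"
    have c: "c \<in> M" "V0 \<subseteq> chart_dom c" "C \<in> tangent_bundle M"
      using ch[OF V0'] by (auto simp: c_def C_def tangent_chart_in)
    obtain p v where z: "z = (p, v)" by fastforce
    have zC: "z \<in> chart_dom C"
      using c0 V0 c z by (auto simp: C_def)
    have "open (chart_map C ` (W \<inter> chart_dom C))"
      using W TM c(3) by (simp add: openin_atlas_topology)
    moreover have "(chart_map c p, v c) \<in> chart_map C ` (W \<inter> chart_dom C)"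
      using zC W z by (force simp: C_def)
    ultimately obtain A E where AE: "open A" "open E" "(chart_map c p, v c) \<in> A \<times> E"
      "A \<times> E \<subseteq> chart_map C ` (W \<inter> chart_dom C)"
      by (metis open_prod_elim)
    obtain V where V: "V \<in> \<B>" "p \<in> V" "V \<subseteq> {q \<in> chart_dom c. chart_map c q \<in> A}"
      using \<B>(3)[OF openin_chart_preimage[OF M c(1) AE(1)], of p] AE(3) V0 c z by auto
    obtain r where r: "0 < r" "ball (v c) r \<subseteq> E"
      using AE by (auto elim: openE)
    \<comment> \<open>A radius below \<open>r / 2\<close> lets the ball about \<open>e\<close> stay
      inside the ball of radius \<open>r\<close> about \<open>v c\<close> although its centre is
      displaced.\<close>
    obtain n where n: "inverse (real (Suc n)) < r / 2"
      using reals_Archimedean[of "r / 2"] r by auto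
    obtain e where e: "e \<in> D" "dist (v c) e < inverse (real (Suc n))"
      using D(2)[of "inverse (real (Suc n))"] by auto
    have "ball e (inverse (real (Suc n))) \<subseteq> ball (v c) r"
    proof
      fix x assume "x \<in> ball e (inverse (real (Suc n)))"
      then have "dist (v c) x < inverse (real (Suc n)) + inverse (real (Suc n))"
        using dist_triangle[of "v c" x e] e by simp
      then show "x \<in> ball (v c) r" using n by simp
    qed
    then have sub: "chart_map c ` (V \<inter> chart_dom c) \<times> ball e (inverse (real (Suc n)))
        \<subseteq> chart_map C ` (W \<inter> chart_dom C)"
      using V(3) r(2) AE(4) by blast
    have "N (V0, V, e, n) \<subseteq> W"
    proof
      fix w assume "w \<in> N (V0, V, e, n)"
      then have w: "w \<in> chart_dom C" "chart_map C w \<in> chart_map C ` (W \<inter> chart_dom C)"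
        using sub by (auto simp: N_def c_def[symmetric] C_def[symmetric] simp del: chart_dom_tangent_chart)
      then show "w \<in> W"
        using inj_on_tangent_chart[OF M c(1)] unfolding C_def[symmetric]
        by (metis (no_types, lifting) IntE image_iff inj_onD)
    qed
    moreover have "z \<in> N (V0, V, e, n)"
      using zC V e c z unfolding N_def
      by (auto simp: c_def[symmetric] C_def[symmetric] dist_commute simp del: chart_dom_tangent_chart)
        (auto simp: C_def)
    ultimately show ?thesis
      using V0' V(1) e(1) by blast
  qed
  ultimately show ?thesis
    unfolding second_countable_def by (intro exI[of _ "N ` ?I"]) blast
qed

lemma fin_dim_smooth_manifold: "smooth_manifold (M :: ('a, 'e::real_inner) atlas) \<Longrightarrow> fin_dim TYPE('e)"
  by (simp add: smooth_manifold_def fin_dim_def)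

lemma smooth_manifold_tangent_bundle:
  fixes M :: "('a, 'e::real_inner) atlas"
  assumes "smooth_manifold M"
  shows "smooth_manifold (tangent_bundle M)"
proof -
  note fd = fin_dim_smooth_manifold[OF assms]
  have M: "smooth_atlas M" "Hausdorff_space (atlas_topology M)" "second_countable (atlas_topology M)"
    using assms by (auto simp: smooth_manifold_def)
  show ?thesis
    unfolding smooth_manifold_def
    using smooth_atlas_tangent_bundle[OF fd M(1)] Hausdorff_tangent_bundle[OF fd M(1,2)]
      second_countable_tangent_bundle[OF fd M(1,3)] fin_dim_prod[OF fd fd]
    by (simp add: fin_dim_def)
qed

section \<open>Tangent maps in charts\<close>

lemma smooth_atlas_inj_on: "smooth_atlas M \<Longrightarrow> c \<in> M \<Longrightarrow> inj_on (chart_map c) (chart_dom c)"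
  by (simp add: smooth_atlas_def)

text \<open>The description in \<open>tangent_map\<close> is satisfied because passing to another
  source chart multiplies the derivative by that of a transition map, which is absorbed by the
  transformation of the components of \<open>v\<close>.\<close>

lemma tangent_map_at:
  assumes M: "smooth_atlas M" and c: "c \<in> M" "p \<in> chart_dom c" and v: "v \<in> tangent_space M p"
    and d: "d \<in> N" "f p \<in> chart_dom d" and diff: "coord_map c d f differentiable (at (chart_map c p))"
  shows "snd (tangent_map M N f (p, v)) d = frechet_derivative (coord_map c d f) (at (chart_map c p)) (v c)"
proof -
  let ?w = "frechet_derivative (coord_map c d f) (at (chart_map c p)) (v c)"
  have w: "?w = frechet_derivative (coord_map c' d f) (at (chart_map c' p)) (v c')"
    if c': "c' \<in> M" "p \<in> chart_dom c'" for c'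
  proof -
    note tr = has_derivative_transition[OF M c'(1) c(1) c'(2) c(2)]
    have "((\<lambda>y. coord_map c d f (transition c' c y)) has_derivative
        (\<lambda>v. frechet_derivative (coord_map c d f) (at (chart_map c p))
          (frechet_derivative (transition c' c) (at (chart_map c' p)) v))) (at (chart_map c' p))"
      using has_derivative_compose[OF tr, of "coord_map c d f"] diff
      by (simp add: chart_inv_map[OF M c'] o_def frechet_derivative_works)
    then have "(coord_map c' d f has_derivative
        (\<lambda>v. frechet_derivative (coord_map c d f) (at (chart_map c p))
          (frechet_derivative (transition c' c) (at (chart_map c' p)) v))) (at (chart_map c' p))"
      by (rule has_derivative_transform_within_open[OF _ open_chart_overlap[OF M c'(1) c(1)]])
        (use c c' in \<open>auto simp: chart_inv_map[OF M]\<close>)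
    from fun_cong[OF frechet_derivative_at[OF this, symmetric], of "v c'"]
    show ?thesis
      using tangent_space_transition[OF v c'(1) c(1) c'(2) c(2)] by simp
  qed
  have "(THE w. \<forall>c\<in>M. p \<in> chart_dom c \<longrightarrow>
      w = frechet_derivative (coord_map c d f) (at (chart_map c p)) (v c)) = ?w"
  proof (rule the_equality)
    show "\<forall>c\<in>M. p \<in> chart_dom c \<longrightarrow>
        ?w = frechet_derivative (coord_map c d f) (at (chart_map c p)) (v c)"
      using w by blast
  qed (use c in blast)
  then show ?thesis
    using d by (simp add: tangent_map_def)
qed

text \<open>The definition offers some charts \<open>c'\<close> and \<open>d'\<close> around each
  point. In prescribed charts \<open>f\<close> is locally the expression in \<open>c'\<close> and
  \<open>d'\<close> composed with transition maps on both sides. The neighbourhoods on which this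
  works also show that \<open>W\<close> is open.\<close>

lemma smooth_map_on_charts:
  fixes M :: "('a, 'e::real_inner) atlas" and N :: "('b, 'f::real_inner) atlas"
  assumes fd: "fin_dim TYPE('e)" "fin_dim TYPE('f)" and M: "smooth_atlas M" and N: "smooth_atlas N"
    and f: "smooth_map_on M N U f" and c: "c \<in> M" and d: "d \<in> N"
  defines "W \<equiv> {p \<in> U \<inter> chart_dom c. f p \<in> chart_dom d}"
  shows "openin (atlas_topology M) W" and "smooth_on (coord_map c d f) (chart_map c ` W)"
proof -
  have *: "\<exists>T. open T \<and> y \<in> T \<and> T \<subseteq> chart_map c ` W \<and> smooth_on (coord_map c d f) T"
    if y: "y \<in> chart_map c ` W" for y
  proof -
    obtain p where p: "p \<in> W" "y = chart_map c p"
      using y by auto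
    then obtain c' d' X where X: "c' \<in> M" "d' \<in> N" "openin (atlas_topology M) X" "p \<in> X"
      "X \<subseteq> U \<inter> chart_dom c'" "f ` X \<subseteq> chart_dom d'"
      "smooth_on (coord_map c' d' f) (chart_map c' ` X)"
      using f unfolding smooth_map_on_def W_def by blast
    define A where "A = chart_map c ` (X \<inter> chart_dom c)"
    define B where "B = chart_map d' ` (chart_dom d' \<inter> chart_dom d)"
    define g where "g y = coord_map c' d' f (transition c c' y)" for y
    have A: "open A" and B: "open B"
      using X M c by (auto simp: A_def B_def openin_atlas_topology intro!: open_chart_overlap[OF N X(2) d])
    have tr: "smooth_on (transition c c') A"
      by (rule smooth_on_subset[OF smooth_on_transition[OF M c X(1)]]) (use X in \<open>auto simp: A_def\<close>)
    have trA: "transition c c' ` A \<subseteq> chart_map c' ` X"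
      using chart_inv_map[OF M c] by (auto simp: A_def)
    have oX: "open (chart_map c' ` X)"
      using X by (intro open_image_openin[OF M]) auto
    have g: "smooth_on g A"
      unfolding g_def by (rule smooth_on_compose[OF fd(1) A oX trA tr X(7)])
    have gp: "g (chart_map c q) = chart_map d' (f q)" if "q \<in> X" "q \<in> chart_dom c" for q
      using that X chart_inv_map[OF M c] chart_inv_map[OF M X(1)] by (auto simp: g_def)
    \<comment> \<open>These are coordinates of points whose images lie in both target charts, so
      that the factorization is valid on \<open>T\<close>.\<close>
    define T where "T = A \<inter> g -` B"
    have T: "open T"
      unfolding T_def by (rule continuous_open_preimage[OF smooth_on_continuous_on[OF g] A B])
    have inW: "\<exists>q. q \<in> X \<and> q \<in> W \<and> z = chart_map c q \<and> f q \<in> chart_dom d \<and> f q \<in> chart_dom d'"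
      if z: "z \<in> T" for z
    proof -
      obtain q where q: "q \<in> X" "q \<in> chart_dom c" "z = chart_map c q" "chart_map d' (f q) \<in> B"
        using z gp by (auto simp: T_def A_def)
      then have "f q \<in> chart_dom d'" using X by auto
      obtain x where x: "x \<in> chart_dom d'" "x \<in> chart_dom d" "chart_map d' (f q) = chart_map d' x"
        using q(4) unfolding B_def by auto
      have "f q = x"
        using inj_onD[OF smooth_atlas_inj_on[OF N X(2)] x(3) \<open>f q \<in> chart_dom d'\<close> x(1)] .
      then have "f q \<in> chart_dom d" using x by simp
      then show ?thesis
        using q X \<open>f q \<in> chart_dom d'\<close> by (auto simp: W_def)
    qed
    have "g ` T \<subseteq> B" by (auto simp: T_def)
    moreover have "smooth_on g T" by (rule smooth_on_subset[OF g]) (auto simp: T_def)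
    moreover have "smooth_on (transition d' d) B"
      unfolding B_def by (rule smooth_on_transition[OF N X(2) d])
    ultimately have "smooth_on (\<lambda>y. transition d' d (g y)) T"
      by (rule smooth_on_compose[OF fd(2) T B])
    then have "smooth_on (coord_map c d f) T"
    proof (rule smooth_on_cong[OF T, rotated])
      fix z assume "z \<in> T"
      then obtain q where q: "q \<in> X" "q \<in> W" "z = chart_map c q" "f q \<in> chart_dom d'"
        using inW by blast
      then have qc: "q \<in> chart_dom c" by (auto simp: W_def)
      show "transition d' d (g z) = coord_map c d f z"
        using q gp[OF q(1) qc] by (simp add: chart_inv_map[OF M c qc] chart_inv_map[OF N X(2) q(4)])
    qed
    moreover have "y \<in> T"
    proof -
      have "p \<in> chart_dom c" "f p \<in> chart_dom d" "f p \<in> chart_dom d'"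
        using p X by (auto simp: W_def)
      then show ?thesis
        using p X gp[of p] by (auto simp: T_def A_def B_def)
    qed
    moreover have "T \<subseteq> chart_map c ` W"
      using inW by blast
    ultimately show ?thesis
      using T by blast
  qed
  have "open (chart_map c ` W)"
    by (subst open_subopen) (use * in blast)
  then show "openin (atlas_topology M) W"
    by (subst openin_chart_iff[OF M c]) (auto simp: W_def)
  show "smooth_on (coord_map c d f) (chart_map c ` W)"
    by (rule smooth_on_local) (use * in blast)
qed

text \<open>Independence of the source chart is \<open>tangent_map_at\<close>. What remains for the
  image to be a tangent vector is compatibility of its components in two target charts, by the chain
  rule on the target side.\<close>

lemma tangent_map_chart:
  fixes M :: "('a, 'e::real_inner) atlas" and N :: "('b, 'f::real_inner) atlas"
  assumes fd: "fin_dim TYPE('e)" "fin_dim TYPE('f)" and M: "smooth_atlas M" and N: "smooth_atlas N"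
    and f: "smooth_map_on M N U f" and c: "c \<in> M" and d: "d \<in> N"
    and z: "z \<in> chart_dom (tangent_chart M c)" "fst z \<in> U" "f (fst z) \<in> chart_dom d"
  shows "tangent_map M N f z \<in> chart_dom (tangent_chart N d)"
    and "chart_map (tangent_chart N d) (tangent_map M N f z) =
      tangent_fun (coord_map c d f) (chart_map (tangent_chart M c) z)"
proof -
  obtain p v where pv: "z = (p, v)" by fastforce
  have p: "p \<in> chart_dom c" "v \<in> tangent_space M p" "p \<in> U" "f p \<in> chart_dom d"
    using z pv by auto
  have D: "(coord_map c e f has_derivative frechet_derivative (coord_map c e f) (at (chart_map c p)))
      (at (chart_map c p))" if "e \<in> N" "f p \<in> chart_dom e" for e
    using p that by (intro smooth_on_has_derivative[OF smooth_map_on_charts(2)[OF fd M N f c that(1)]]) auto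
  have comp: "snd (tangent_map M N f z) e = frechet_derivative (coord_map c e f) (at (chart_map c p)) (v c)"
    if "e \<in> N" "f p \<in> chart_dom e" for e
    unfolding pv using differentiableI[OF D[OF that]]
    by (intro tangent_map_at M c p that)
  have "snd (tangent_map M N f z) \<in> tangent_space N (f p)"
    unfolding tangent_space_def
  proof (intro CollectI conjI ballI allI impI)
    fix e assume "e \<notin> N \<or> f p \<notin> chart_dom e"
    then show "snd (tangent_map M N f z) e = 0"
      by (auto simp: tangent_map_def pv)
  next
    fix e e' assume e: "e \<in> N" "e' \<in> N" "f p \<in> chart_dom e \<and> f p \<in> chart_dom e'"
    let ?W = "{q \<in> U \<inter> chart_dom c. f q \<in> chart_dom e}"
    have tr: "(transition e e' has_derivative frechet_derivative (transition e e') (at (chart_map e (f p))))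
        (at (coord_map c e f (chart_map c p)))"
      using has_derivative_transition[OF N, of e e' "f p"] e by (simp add: chart_inv_map[OF M c p(1)])
    have oW: "open (chart_map c ` ?W)"
      by (rule open_image_openin[OF M c smooth_map_on_charts(1)[OF fd M N f c e(1)]]) auto
    have eq: "transition e e' (coord_map c e f y) = coord_map c e' f y" if "y \<in> chart_map c ` ?W" for y
      using that by (auto simp: chart_inv_map[OF M c] chart_inv_map[OF N e(1)])
    have pW: "chart_map c p \<in> chart_map c ` ?W"
      using p e by auto
    have "((\<lambda>y. transition e e' (coord_map c e f y)) has_derivative
        (\<lambda>w. frechet_derivative (transition e e') (at (chart_map e (f p)))
          (frechet_derivative (coord_map c e f) (at (chart_map c p)) w))) (at (chart_map c p))"
      using has_derivative_compose[OF D tr] e by auto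
    then have "(coord_map c e' f has_derivative
        (\<lambda>w. frechet_derivative (transition e e') (at (chart_map e (f p)))
          (frechet_derivative (coord_map c e f) (at (chart_map c p)) w))) (at (chart_map c p))"
      by (rule has_derivative_transform_within_open[OF _ oW pW eq])
    from fun_cong[OF frechet_derivative_at[OF this, symmetric], of "v c"]
    show "snd (tangent_map M N f z) e' = frechet_derivative (transition e e') (at (chart_map e (f p)))
        (snd (tangent_map M N f z) e)"
      using comp e by simp
  qed
  moreover have fst: "fst (tangent_map M N f z) = f p"
    by (simp add: tangent_map_def pv)
  ultimately show "tangent_map M N f z \<in> chart_dom (tangent_chart N d)"
    using p by (cases "tangent_map M N f z") simp
  have "chart_map (tangent_chart N d) (tangent_map M N f z) =
      (chart_map d (f p), snd (tangent_map M N f z) d)"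
    using fst by (metis chart_map_tangent_chart prod.collapse)
  then show "chart_map (tangent_chart N d) (tangent_map M N f z) =
      tangent_fun (coord_map c d f) (chart_map (tangent_chart M c) z)"
    using comp[OF d p(4)] by (simp add: pv tangent_fun_def chart_inv_map[OF M c p(1)])
qed

subsection \<open>Products\<close>

definition prod_chart :: "('a, 'e) chart \<Rightarrow> ('b, 'f) chart \<Rightarrow> ('a \<times> 'b, 'e \<times> 'f) chart" where
  "prod_chart c d = Chart (chart_dom c \<times> chart_dom d) (\<lambda>(x, y). (chart_map c x, chart_map d y))"

lemma chart_dom_prod_chart [simp]: "chart_dom (prod_chart c d) = chart_dom c \<times> chart_dom d"
  by (simp add: prod_chart_def)

lemma chart_map_prod_chart: "chart_map (prod_chart c d) z = (chart_map c (fst z), chart_map d (snd z))"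
  by (simp add: prod_chart_def case_prod_beta)

lemma product_manifold_eq: "product_manifold M N = {prod_chart c d |c d. c \<in> M \<and> d \<in> N}"
  by (simp add: product_manifold_def prod_chart_def)

lemma prod_chart_in: "c \<in> M \<Longrightarrow> d \<in> N \<Longrightarrow> prod_chart c d \<in> product_manifold M N"
  by (auto simp: product_manifold_eq)

lemma prod_chart_image: "chart_map (prod_chart c d) ` (A \<times> B) = (chart_map c ` A) \<times> (chart_map d ` B)"
  by (auto simp: chart_map_prod_chart image_iff)

lemma inj_on_prod_chart:
  "inj_on (chart_map c) (chart_dom c) \<Longrightarrow> inj_on (chart_map d) (chart_dom d) \<Longrightarrow>
    inj_on (chart_map (prod_chart c d)) (chart_dom (prod_chart c d))"
  by (auto simp: inj_on_def chart_map_prod_chart)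

lemma chart_inv_prod_chart:
  assumes "smooth_atlas M" "smooth_atlas N" "c \<in> M" "d \<in> N" "x \<in> chart_dom c" "y \<in> chart_dom d"
  shows "chart_inv (prod_chart c d) (chart_map c x, chart_map d y) = (x, y)"
proof -
  have "inj_on (chart_map (prod_chart c d)) (chart_dom (prod_chart c d))"
    using assms by (intro inj_on_prod_chart smooth_atlas_inj_on)
  from inv_into_f_f[OF this, of "(x, y)"] show ?thesis
    using assms by (simp add: chart_inv_def chart_map_prod_chart)
qed

lemma smooth_atlas_product:
  fixes M :: "('a, 'e::real_inner) atlas" and N :: "('b, 'f::real_inner) atlas"
  assumes fd: "fin_dim TYPE('e)" "fin_dim TYPE('f)" and M: "smooth_atlas M" and N: "smooth_atlas N"
  shows "smooth_atlas (product_manifold M N)"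
proof -
  have *: "open (chart_map C ` (chart_dom C \<inter> chart_dom D)) \<and>
      smooth_on (transition C D) (chart_map C ` (chart_dom C \<inter> chart_dom D))"
    if C: "C \<in> product_manifold M N" "D \<in> product_manifold M N" for C D
  proof -
    obtain c d c' d' where cd: "c \<in> M" "d \<in> N" "C = prod_chart c d" "c' \<in> M" "d' \<in> N" "D = prod_chart c' d'"
      using C by (auto simp: product_manifold_eq)
    let ?A = "chart_map c ` (chart_dom c \<inter> chart_dom c')" and ?B = "chart_map d ` (chart_dom d \<inter> chart_dom d')"
    have im: "chart_map C ` (chart_dom C \<inter> chart_dom D) = ?A \<times> ?B"
      by (simp add: cd Times_Int_Times prod_chart_image)
    have A: "open ?A" and B: "open ?B"
      using cd by (auto intro: open_chart_overlap[OF M] open_chart_overlap[OF N])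
    then have o: "open (?A \<times> ?B)" by (rule open_Times)
    have "smooth_on (\<lambda>z. transition c c' (fst z)) (?A \<times> ?B)"
      by (rule smooth_on_compose[OF fd(1) o A _ smooth_on_bounded_linear[OF bounded_linear_fst o]
          smooth_on_transition[OF M cd(1,4)]]) auto
    moreover have "smooth_on (\<lambda>z. transition d d' (snd z)) (?A \<times> ?B)"
      by (rule smooth_on_compose[OF fd(2) o B _ smooth_on_bounded_linear[OF bounded_linear_snd o]
          smooth_on_transition[OF N cd(2,5)]]) auto
    ultimately have "smooth_on (\<lambda>z. (transition c c' (fst z), transition d d' (snd z))) (?A \<times> ?B)"
      by (rule smooth_on_Pair[OF o])
    then have "smooth_on (transition C D) (?A \<times> ?B)"
      by (rule smooth_on_cong[OF o, rotated])
        (auto simp: cd chart_inv_prod_chart[OF M N cd(1,2)] chart_map_prod_chart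
          chart_inv_map[OF M cd(1)] chart_inv_map[OF N cd(2)])
    then show ?thesis using o im by simp
  qed
  moreover have "inj_on (chart_map C) (chart_dom C)" if "C \<in> product_manifold M N" for C
    using that by (auto simp only: product_manifold_eq
        intro!: inj_on_prod_chart smooth_atlas_inj_on[OF M] smooth_atlas_inj_on[OF N])
  ultimately show ?thesis
    unfolding smooth_atlas_def by (metis Int_absorb)
qed

lemma smooth_map_on_fst_snd:
  fixes M :: "('a, 'e::real_inner) atlas" and N :: "('b, 'f::real_inner) atlas"
  assumes fd: "fin_dim TYPE('e)" "fin_dim TYPE('f)" and M: "smooth_atlas M" and N: "smooth_atlas N"
  shows "smooth_map_on (product_manifold M N) M (carrier (product_manifold M N)) fst"
    and "smooth_map_on (product_manifold M N) N (carrier (product_manifold M N)) snd"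
proof -
  note P = smooth_atlas_product[OF fd M N]
  have U: "openin (atlas_topology (product_manifold M N)) (carrier (product_manifold M N))"
    by (metis openin_topspace topspace_atlas_topology[OF P])
  have chart: "\<exists>c d. c \<in> M \<and> d \<in> N \<and> z \<in> chart_dom (prod_chart c d)"
    if "z \<in> carrier (product_manifold M N)" for z
    using that unfolding carrier_def product_manifold_eq by blast
  have co: "coord_map (prod_chart c d) c fst y = fst y" "coord_map (prod_chart c d) d snd y = snd y"
    if "c \<in> M" "d \<in> N" "y \<in> chart_map (prod_chart c d) ` chart_dom (prod_chart c d)" for c d y
    using that by (auto simp: chart_map_prod_chart chart_inv_prod_chart[OF M N])
  show "smooth_map_on (product_manifold M N) M (carrier (product_manifold M N)) fst"
    unfolding smooth_map_on_def
  proof (intro conjI U ballI)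
    fix z assume "z \<in> carrier (product_manifold M N)"
    then obtain c d where cd: "c \<in> M" "d \<in> N" "z \<in> chart_dom (prod_chart c d)"
      using chart by blast
    note C = prod_chart_in[OF cd(1,2)]
    have "smooth_on (coord_map (prod_chart c d) c fst) (chart_map (prod_chart c d) ` chart_dom (prod_chart c d))"
      by (rule smooth_on_cong[OF open_chart_image[OF P C] co(1)[symmetric, OF cd(1,2)]
          smooth_on_bounded_linear[OF bounded_linear_fst open_chart_image[OF P C]]])
    then show "\<exists>C\<in>product_manifold M N. \<exists>D\<in>M. \<exists>W. openin (atlas_topology (product_manifold M N)) W \<and>
        z \<in> W \<and> W \<subseteq> carrier (product_manifold M N) \<inter> chart_dom C \<and> fst ` W \<subseteq> chart_dom D \<and>
        smooth_on (coord_map C D fst) (chart_map C ` W)"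
      using cd C openin_chart_dom[OF P C]
      by (intro bexI[OF _ C] bexI[OF _ cd(1)] exI[of _ "chart_dom (prod_chart c d)"])
        (auto simp: carrier_def)
  qed
  show "smooth_map_on (product_manifold M N) N (carrier (product_manifold M N)) snd"
    unfolding smooth_map_on_def
  proof (intro conjI U ballI)
    fix z assume "z \<in> carrier (product_manifold M N)"
    then obtain c d where cd: "c \<in> M" "d \<in> N" "z \<in> chart_dom (prod_chart c d)"
      using chart by blast
    note C = prod_chart_in[OF cd(1,2)]
    have "smooth_on (coord_map (prod_chart c d) d snd) (chart_map (prod_chart c d) ` chart_dom (prod_chart c d))"
      by (rule smooth_on_cong[OF open_chart_image[OF P C] co(2)[symmetric, OF cd(1,2)]
          smooth_on_bounded_linear[OF bounded_linear_snd open_chart_image[OF P C]]])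
    then show "\<exists>C\<in>product_manifold M N. \<exists>D\<in>N. \<exists>W. openin (atlas_topology (product_manifold M N)) W \<and>
        z \<in> W \<and> W \<subseteq> carrier (product_manifold M N) \<inter> chart_dom C \<and> snd ` W \<subseteq> chart_dom D \<and>
        smooth_on (coord_map C D snd) (chart_map C ` W)"
      using cd C openin_chart_dom[OF P C]
      by (intro bexI[OF _ C] bexI[OF _ cd(2)] exI[of _ "chart_dom (prod_chart c d)"])
        (auto simp: carrier_def)
  qed
qed

text \<open>In product charts \<open>fst\<close> and \<open>snd\<close> are the linear projections,
  so their tangent maps project point and vector alike. Taken together they regroup the coordinates
  by \<open>flip\<close>.\<close>

lemma tangent_product_chart:
  fixes M :: "('a, 'e::real_inner) atlas"
  assumes fd: "fin_dim TYPE('e)" and M: "smooth_atlas M" and ab: "a \<in> M" "b \<in> M"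
    and z: "z \<in> chart_dom (tangent_chart (product_manifold M M) (prod_chart a b))"
  shows "tangent_product M M z \<in> chart_dom (prod_chart (tangent_chart M a) (tangent_chart M b))"
    and "chart_map (prod_chart (tangent_chart M a) (tangent_chart M b)) (tangent_product M M z) =
      flip (chart_map (tangent_chart (product_manifold M M) (prod_chart a b)) z)"
proof -
  let ?P = "product_manifold M M" and ?C = "prod_chart a b"
  note P = smooth_atlas_product[OF fd fd M M]
  note C = prod_chart_in[OF ab]
  note sm = smooth_map_on_fst_snd[OF fd fd M M]
  have zU: "fst z \<in> chart_dom ?C"
    using z by auto
  then have zP: "fst z \<in> carrier ?P"
    using C by (auto simp only: carrier_def)
  have zab: "fst (fst z) \<in> chart_dom a" "snd (fst z) \<in> chart_dom b"
    using zU by auto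
  note t1 = tangent_map_chart[OF fin_dim_prod[OF fd fd] fd P M sm(1) C ab(1) z zP zab(1)]
  note t2 = tangent_map_chart[OF fin_dim_prod[OF fd fd] fd P M sm(2) C ab(2) z zP zab(2)]
  show "tangent_product M M z \<in> chart_dom (prod_chart (tangent_chart M a) (tangent_chart M b))"
    using t1(1) t2(1) by (simp add: tangent_product_def)
  let ?I = "chart_map ?C ` chart_dom ?C"
  have co: "fst y = coord_map ?C a fst y" "snd y = coord_map ?C b snd y"
    if "y \<in> ?I" for y
    using that by (auto simp: chart_map_prod_chart chart_inv_prod_chart[OF M M ab])
  have y: "chart_map ?C (fst z) \<in> ?I"
    using zU by blast
  have "(coord_map ?C a fst has_derivative fst) (at (chart_map ?C (fst z)))"
    by (rule has_derivative_transform_within_open[OF bounded_linear_imp_has_derivative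
        open_chart_image[OF P C] y co(1)]) (rule bounded_linear_fst)
  note 1 = tangent_fun_eq[OF this]
  have "(coord_map ?C b snd has_derivative snd) (at (chart_map ?C (fst z)))"
    by (rule has_derivative_transform_within_open[OF bounded_linear_imp_has_derivative
        open_chart_image[OF P C] y co(2)]) (rule bounded_linear_snd)
  note 2 = tangent_fun_eq[OF this]
  have zC: "chart_map (tangent_chart ?P ?C) z = (chart_map ?C (fst z), snd z ?C)"
    by (metis chart_map_tangent_chart prod.collapse)
  show "chart_map (prod_chart (tangent_chart M a) (tangent_chart M b)) (tangent_product M M z) =
      flip (chart_map (tangent_chart ?P ?C) z)"
    using t1(2) t2(2) co[OF y]
    by (simp add: chart_map_prod_chart[of "tangent_chart M a"] tangent_product_def zC 1 2 flip_def case_prod_beta)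
qed

section \<open>The canonical involution\<close>

lemma fst_fst_flip [simp]: "fst (fst (flip z)) = fst (fst z)"
  by (simp add: flip_def case_prod_beta)

abbreviation double_chart ::
  "('a, 'e::real_inner) atlas \<Rightarrow> ('a, 'e) chart \<Rightarrow> ((('a, 'e) tangent, 'e \<times> 'e) tangent, ('e \<times> 'e) \<times> ('e \<times> 'e)) chart" where
  "double_chart M c \<equiv> tangent_chart (tangent_bundle M) (tangent_chart M c)"

lemma double_chart_image:
  fixes M :: "('a, 'e::real_inner) atlas"
  assumes fd: "fin_dim TYPE('e)" and M: "smooth_atlas M" and c: "c \<in> M"
    and W: "W \<subseteq> chart_dom (tangent_chart M c)"
  shows "chart_map (double_chart M c) ` tangent_over (tangent_bundle M) W =
    chart_map (tangent_chart M c) ` W \<times> UNIV"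
  by (rule tangent_chart_image[OF smooth_atlas_tangent_bundle[OF fd M] tangent_chart_in[OF c] W])

lemma double_chart_dom_image:
  fixes M :: "('a, 'e::real_inner) atlas"
  assumes fd: "fin_dim TYPE('e)" and M: "smooth_atlas M" and c: "c \<in> M"
  shows "chart_map (double_chart M c) ` chart_dom (double_chart M c) =
    (chart_map c ` chart_dom c \<times> UNIV) \<times> UNIV"
proof -
  have "chart_dom (double_chart M c) = tangent_over (tangent_bundle M) (chart_dom (tangent_chart M c))"
    by (simp add: tangent_over_def)
  moreover have "chart_dom (tangent_chart M c) = tangent_over M (chart_dom c)"
    by (simp add: tangent_over_def)
  ultimately show ?thesis
    using double_chart_image[OF fd M c order_refl] tangent_chart_image[OF M c order_refl] by simp
qed

lemma mem_double_chart_iff: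
  assumes "z \<in> carrier (tangent_bundle (tangent_bundle M))"
  shows "z \<in> chart_dom (double_chart M c) \<longleftrightarrow> fst (fst z) \<in> chart_dom c"
  using assms by (auto simp: carrier_def tangent_bundle_def)

lemma double_chart_in: "c \<in> M \<Longrightarrow> double_chart M c \<in> tangent_bundle (tangent_bundle M)"
  by (intro tangent_chart_in)

lemma double_chart_carrier:
  "c \<in> M \<Longrightarrow> z \<in> chart_dom (double_chart M c) \<Longrightarrow> z \<in> carrier (tangent_bundle (tangent_bundle M))"
  using double_chart_in unfolding carrier_def by blast

lemma double_chart_obtain:
  assumes "z \<in> carrier (tangent_bundle (tangent_bundle M))"
  obtains c where "c \<in> M" "z \<in> chart_dom (double_chart M c)"
  using assms by (auto simp: carrier_def tangent_bundle_def)

text \<open>A transition between tangent charts equals \<open>tangent_fun\<close> of the one below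
  only on the open overlap; this is enough to differentiate the equality once more.\<close>

lemma double_chart_transition:
  fixes M :: "('a, 'e::real_inner) atlas"
  assumes fd: "fin_dim TYPE('e)" and M: "smooth_atlas M" and cd: "c \<in> M" "d \<in> M"
    and z: "z \<in> chart_dom (double_chart M c)" "z \<in> chart_dom (double_chart M d)"
  shows "chart_map (double_chart M d) z =
    tangent_fun (tangent_fun (transition c d)) (chart_map (double_chart M c) z)"
proof -
  let ?C = "tangent_chart M c" and ?D = "tangent_chart M d"
  let ?S = "chart_map c ` (chart_dom c \<inter> chart_dom d)"
  note TM = smooth_atlas_tangent_bundle[OF fd M]
  note C = tangent_chart_in[OF cd(1)] and D = tangent_chart_in[OF cd(2)]
  obtain y e where ye: "chart_map (double_chart M c) z = (y, e)" by (meson surj_pair)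
  have y: "y \<in> chart_map ?C ` (chart_dom ?C \<inter> chart_dom ?D)"
    using z ye by (cases z) (auto simp: image_iff)
  then have y': "y \<in> ?S \<times> UNIV"
    by (auto simp: image_iff)
  have o: "open (?S \<times> (UNIV :: 'e set))"
    by (intro open_Times open_chart_overlap[OF M cd] open_UNIV)
  have eq: "transition ?C ?D x = tangent_fun (transition c d) x" if "x \<in> ?S \<times> UNIV" for x
    using that transition_tangent_chart[OF M cd] by (cases x) blast
  have "chart_map (double_chart M d) z = transition (double_chart M c) (double_chart M d) (y, e)"
    using chart_inv_map[OF smooth_atlas_tangent_bundle[OF fin_dim_prod[OF fd fd] TM] double_chart_in[OF cd(1)] z(1)]
      ye by simp
  also have "\<dots> = tangent_fun (transition ?C ?D) (y, e)"
    by (rule transition_tangent_chart[OF TM C D y])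
  also have "\<dots> = tangent_fun (tangent_fun (transition c d)) (y, e)"
  proof (rule tangent_fun_cong[OF o y' eq])
    show "transition ?C ?D differentiable (at y)"
      using smooth_on_has_derivative[OF smooth_on_transition[OF TM C D] y] by (rule differentiableI)
  qed
  finally show ?thesis
    by (simp add: ye)
qed

text \<open>The description has a solution because the vector with flipped coordinates in one chart
  has flipped coordinates in every other: transitions are iterated tangent maps, which commute with
  \<open>flip\<close>. It is unique by injectivity of a chart.\<close>

lemma canonical_involution_chart:
  fixes Q :: "('a, 'e::real_inner) atlas"
  assumes fd: "fin_dim TYPE('e)" and Q: "smooth_atlas Q" and c: "c \<in> Q"
    and z: "z \<in> chart_dom (double_chart Q c)"
  shows "canonical_involution Q z \<in> chart_dom (double_chart Q c)"
    and "chart_map (double_chart Q c) (canonical_involution Q z) = flip (chart_map (double_chart Q c) z)"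
proof -
  note TQ = smooth_atlas_tangent_bundle[OF fd Q]
  note inj = inj_on_tangent_chart[OF TQ tangent_chart_in]
  define P where "P w \<longleftrightarrow> (\<forall>d\<in>Q. z \<in> chart_dom (double_chart Q d) \<longrightarrow>
    w \<in> chart_dom (double_chart Q d) \<and>
    chart_map (double_chart Q d) w = flip (chart_map (double_chart Q d) z))" for w
  have unique: "w = w'" if "P w" "P w'" for w w'
    using that c z inj[OF c] unfolding P_def by (metis inj_onD)
  have "chart_map (double_chart Q c) z \<in> (chart_map c ` chart_dom c \<times> UNIV) \<times> UNIV"
    using z double_chart_dom_image[OF fd Q c] by blast
  then have "flip (chart_map (double_chart Q c) z) \<in> (chart_map c ` chart_dom c \<times> UNIV) \<times> UNIV"
    unfolding mem_Times_iff by simp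
  then have "flip (chart_map (double_chart Q c) z) \<in>
      chart_map (double_chart Q c) ` chart_dom (double_chart Q c)"
    unfolding double_chart_dom_image[OF fd Q c] .
  then obtain w where w: "w \<in> chart_dom (double_chart Q c)"
    "chart_map (double_chart Q c) w = flip (chart_map (double_chart Q c) z)"
    by (elim imageE) simp
  \<comment> \<open>As \<open>flip\<close> keeps the base point in \<open>Q\<close>, the vectors
    \<open>w\<close> and \<open>z\<close> lie in the same double charts.\<close>
  have "chart_map c (fst (fst w)) = chart_map c (fst (fst z))"
    using arg_cong[OF w(2), of "\<lambda>x. fst (fst x)"] by (cases z; cases w) (auto simp: case_prod_beta)
  then have base: "fst (fst w) = fst (fst z)"
    using w(1) z by (intro inj_onD[OF smooth_atlas_inj_on[OF Q c]]) auto
  have "P w"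
    unfolding P_def
  proof (intro ballI impI)
    fix d assume d: "d \<in> Q" "z \<in> chart_dom (double_chart Q d)"
    have wd: "w \<in> chart_dom (double_chart Q d)"
      using mem_double_chart_iff[OF double_chart_carrier[OF c w(1)]]
        mem_double_chart_iff[OF double_chart_carrier[OF c z]] d base by metis
    have "fst (fst (chart_map (double_chart Q c) z)) \<in> chart_map c ` (chart_dom c \<inter> chart_dom d)"
      using z d(2) by (cases z) auto
    then have "tangent_fun (tangent_fun (transition c d)) (flip (chart_map (double_chart Q c) z)) =
        flip (tangent_fun (tangent_fun (transition c d)) (chart_map (double_chart Q c) z))"
      by (rule tangent_fun_tangent_fun_flip[OF fd open_chart_overlap[OF Q c d(1)] _
            smooth_on_transition[OF Q c d(1)]])
    then show "w \<in> chart_dom (double_chart Q d) \<and>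
        chart_map (double_chart Q d) w = flip (chart_map (double_chart Q d) z)"
      using double_chart_transition[OF fd Q c d(1) w(1) wd] double_chart_transition[OF fd Q c d(1) z d(2)]
        w(2) wd by simp
  qed
  have "canonical_involution Q z = (THE w. P w)"
    unfolding canonical_involution_def P_def Let_def flip_def ..
  also have "\<dots> = w"
    using \<open>P w\<close> unique by blast
  finally show "canonical_involution Q z \<in> chart_dom (double_chart Q c)"
    "chart_map (double_chart Q c) (canonical_involution Q z) = flip (chart_map (double_chart Q c) z)"
    using w by simp_all
qed

lemma canonical_involution_involutive:
  fixes Q :: "('a, 'e::real_inner) atlas"
  assumes fd: "fin_dim TYPE('e)" and Q: "smooth_atlas Q" and z: "z \<in> carrier (tangent_bundle (tangent_bundle Q))"
  shows "canonical_involution Q (canonical_involution Q z) = z"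
proof -
  obtain c where c: "c \<in> Q" "z \<in> chart_dom (double_chart Q c)"
    using z by (rule double_chart_obtain)
  note k = canonical_involution_chart[OF fd Q c(1)]
  show ?thesis
    by (rule inj_onD[OF inj_on_tangent_chart[OF smooth_atlas_tangent_bundle[OF fd Q] tangent_chart_in[OF c(1)]]])
      (use k(1)[OF k(1)[OF c(2)]] k(2)[OF k(1)[OF c(2)]] k(2)[OF c(2)] c(2) in simp_all)
qed

lemma involution_image_chart:
  fixes Q :: "('a, 'e::real_inner) atlas"
  assumes fd: "fin_dim TYPE('e)" and Q: "smooth_atlas Q" and c: "c \<in> Q"
    and W: "W \<subseteq> chart_dom (tangent_chart Q c)" "openin (atlas_topology (tangent_bundle Q)) W"
  defines "X \<equiv> canonical_involution Q ` tangent_over (tangent_bundle Q) W"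
  shows "X \<subseteq> chart_dom (double_chart Q c)"
    and "chart_map (double_chart Q c) ` X = flip ` (chart_map (tangent_chart Q c) ` W \<times> UNIV)"
    and "openin (atlas_topology (tangent_bundle (tangent_bundle Q))) X"
proof -
  note TQ = smooth_atlas_tangent_bundle[OF fd Q]
  note TTQ = smooth_atlas_tangent_bundle[OF fin_dim_prod[OF fd fd] TQ]
  have sub: "tangent_over (tangent_bundle Q) W \<subseteq> chart_dom (double_chart Q c)"
    using W(1) by (auto simp: tangent_over_def)
  then show X: "X \<subseteq> chart_dom (double_chart Q c)"
    unfolding X_def using canonical_involution_chart(1)[OF fd Q c] by blast
  have "chart_map (double_chart Q c) ` X = (\<lambda>z. flip (chart_map (double_chart Q c) z)) ` tangent_over (tangent_bundle Q) W"
    unfolding X_def image_image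
    using canonical_involution_chart(2)[OF fd Q c] sub by (intro image_cong) auto
  then show im: "chart_map (double_chart Q c) ` X = flip ` (chart_map (tangent_chart Q c) ` W \<times> UNIV)"
    unfolding double_chart_image[OF fd Q c W(1), symmetric] image_image .
  have "open (chart_map (tangent_chart Q c) ` W)"
    by (rule open_image_openin[OF TQ tangent_chart_in[OF c] W(2,1)])
  then show "openin (atlas_topology (tangent_bundle (tangent_bundle Q))) X"
    unfolding openin_chart_iff[OF TTQ double_chart_in[OF c] X] im
    by (intro open_flip_image open_Times open_UNIV)
qed

lemma openin_involution_image:
  fixes Q :: "('a, 'e::real_inner) atlas"
  assumes fd: "fin_dim TYPE('e)" and Q: "smooth_atlas Q"
    and U: "openin (atlas_topology (tangent_bundle Q)) U"
  shows "openin (atlas_topology (tangent_bundle (tangent_bundle Q)))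
    (canonical_involution Q ` tangent_over (tangent_bundle Q) U)"
proof -
  note TQ = smooth_atlas_tangent_bundle[OF fd Q]
  have "U \<subseteq> (\<Union>c\<in>Q. chart_dom (tangent_chart Q c))"
    using U unfolding openin_atlas_topology[OF TQ] by (auto simp: carrier_def tangent_bundle_def)
  then have "canonical_involution Q ` tangent_over (tangent_bundle Q) U =
      (\<Union>c\<in>Q. canonical_involution Q ` tangent_over (tangent_bundle Q) (U \<inter> chart_dom (tangent_chart Q c)))"
    unfolding tangent_over_def by blast
  moreover have "openin (atlas_topology (tangent_bundle (tangent_bundle Q)))
      (canonical_involution Q ` tangent_over (tangent_bundle Q) (U \<inter> chart_dom (tangent_chart Q c)))"
    if "c \<in> Q" for c
    by (intro involution_image_chart(3)[OF fd Q that] openin_Int U openin_chart_dom[OF TQ] tangent_chart_in that)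
      auto
  ultimately show ?thesis
    by auto
qed

section \<open>The tangent lift in charts\<close>

lemma tangent_lift_chart:
  fixes Q :: "('a, 'e::real_inner) atlas"
  assumes fd: "fin_dim TYPE('e)" and Q: "smooth_atlas Q" and cab: "c \<in> Q" "a \<in> Q" "b \<in> Q"
    and R: "smooth_map_on (tangent_bundle Q) (product_manifold Q Q) U R"
    and z: "z \<in> chart_dom (double_chart Q c)" "fst (canonical_involution Q z) \<in> U"
      "R (fst (canonical_involution Q z)) \<in> chart_dom (prod_chart a b)"
  shows "tangent_lift Q R z \<in> chart_dom (prod_chart (tangent_chart Q a) (tangent_chart Q b))"
    and "chart_map (prod_chart (tangent_chart Q a) (tangent_chart Q b)) (tangent_lift Q R z) =
      flip (tangent_fun (coord_map (tangent_chart Q c) (prod_chart a b) R) (flip (chart_map (double_chart Q c) z)))"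
proof -
  note TQ = smooth_atlas_tangent_bundle[OF fd Q]
  note k = canonical_involution_chart[OF fd Q cab(1) z(1)]
  note t = tangent_map_chart[OF fin_dim_prod[OF fd fd] fin_dim_prod[OF fd fd] TQ
      smooth_atlas_product[OF fd fd Q Q] R tangent_chart_in[OF cab(1)] prod_chart_in[OF cab(2,3)] k(1) z(2,3)]
  note p = tangent_product_chart[OF fd Q cab(2,3) t(1)]
  show "tangent_lift Q R z \<in> chart_dom (prod_chart (tangent_chart Q a) (tangent_chart Q b))"
    using p(1) unfolding tangent_lift_def o_apply .
  show "chart_map (prod_chart (tangent_chart Q a) (tangent_chart Q b)) (tangent_lift Q R z) =
      flip (tangent_fun (coord_map (tangent_chart Q c) (prod_chart a b) R) (flip (chart_map (double_chart Q c) z)))"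
    using p(2) unfolding tangent_lift_def o_apply t(2) k(2) .
qed

text \<open>Such a \<open>y\<close> is the coordinate vector of the involution of some
  \<open>w\<close> over the domain of the expression for \<open>R\<close>. Applying the involution
  again returns \<open>w\<close>, which verifies the conditions for the chart formula of the
  lift.\<close>

lemma coord_map_tangent_lift:
  fixes Q :: "('a, 'e::real_inner) atlas"
  assumes fd: "fin_dim TYPE('e)" and Q: "smooth_atlas Q" and cab: "c \<in> Q" "a \<in> Q" "b \<in> Q"
    and R: "smooth_map_on (tangent_bundle Q) (product_manifold Q Q) U R"
    and y: "y \<in> flip ` (chart_map (tangent_chart Q c) `
      {p \<in> U \<inter> chart_dom (tangent_chart Q c). R p \<in> chart_dom (prod_chart a b)} \<times> UNIV)"
  shows "coord_map (double_chart Q c) (prod_chart (tangent_chart Q a) (tangent_chart Q b)) (tangent_lift Q R) y =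
    flip (tangent_fun (coord_map (tangent_chart Q c) (prod_chart a b) R) (flip y))"
proof -
  let ?W = "{p \<in> U \<inter> chart_dom (tangent_chart Q c). R p \<in> chart_dom (prod_chart a b)}"
  note TQ = smooth_atlas_tangent_bundle[OF fd Q]
  have "?W \<subseteq> chart_dom (tangent_chart Q c)" by blast
  from y[folded double_chart_image[OF fd Q cab(1) this]] obtain w where
    w: "w \<in> tangent_over (tangent_bundle Q) ?W" "y = flip (chart_map (double_chart Q c) w)"
    by (elim imageE) simp
  have fw: "fst w \<in> U" "R (fst w) \<in> chart_dom (prod_chart a b)"
    using w(1) unfolding tangent_over_def by (elim SigmaE; simp)+
  have wc: "w \<in> chart_dom (double_chart Q c)"
    using w(1) unfolding tangent_over_def chart_dom_tangent_chart[of "tangent_bundle Q"] by blast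
  define z where "z = canonical_involution Q w"
  note k = canonical_involution_chart[OF fd Q cab(1) wc, folded z_def]
  have kz: "canonical_involution Q z = w"
    unfolding z_def by (rule canonical_involution_involutive[OF fd Q double_chart_carrier[OF cab(1) wc]])
  have "chart_inv (double_chart Q c) y = z"
    unfolding w(2) k(2)[symmetric]
    by (rule chart_inv_map[OF smooth_atlas_tangent_bundle[OF fin_dim_prod[OF fd fd] TQ] double_chart_in[OF cab(1)] k(1)])
  then show ?thesis
    using tangent_lift_chart(2)[OF fd Q cab R k(1), unfolded kz, OF fw] k(2) w(2) by simp
qed

lemma smooth_map_on_tangent_lift:
  fixes Q :: "('a, 'e::real_inner) atlas"
  assumes fd: "fin_dim TYPE('e)" and Q: "smooth_atlas Q"
    and R: "smooth_map_on (tangent_bundle Q) (product_manifold Q Q) U R"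
  shows "smooth_map_on (tangent_bundle (tangent_bundle Q)) (product_manifold (tangent_bundle Q) (tangent_bundle Q))
    (canonical_involution Q ` tangent_over (tangent_bundle Q) U) (tangent_lift Q R)"
  unfolding smooth_map_on_def
proof (intro conjI ballI)
  let ?\<kappa> = "canonical_involution Q"
  note TQ = smooth_atlas_tangent_bundle[OF fd Q]
  note fd2 = fin_dim_prod[OF fd fd]
  note TTQ = smooth_atlas_tangent_bundle[OF fd2 TQ]
  have U: "openin (atlas_topology (tangent_bundle Q)) U"
    using R by (simp add: smooth_map_on_def)
  then show "openin (atlas_topology (tangent_bundle (tangent_bundle Q))) (?\<kappa> ` tangent_over (tangent_bundle Q) U)"
    by (rule openin_involution_image[OF fd Q])
  have Uc: "U \<subseteq> carrier (tangent_bundle Q)"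
    using U by (simp add: openin_atlas_topology[OF TQ])
  fix z assume "z \<in> ?\<kappa> ` tangent_over (tangent_bundle Q) U"
  then obtain w where w: "w \<in> tangent_over (tangent_bundle Q) U" "z = ?\<kappa> w"
    by auto
  then have wU: "fst w \<in> U" by (auto simp: tangent_over_def)
  then obtain c where c: "c \<in> Q" "fst w \<in> chart_dom (tangent_chart Q c)"
    using Uc tangent_bundle_obtain_chart by (metis subsetD)
  obtain a b where ab: "a \<in> Q" "b \<in> Q" "R (fst w) \<in> chart_dom (prod_chart a b)"
    using R wU unfolding smooth_map_on_def product_manifold_eq by blast
  let ?C = "tangent_chart Q c" and ?P = "prod_chart a b"
  define W where "W = {p \<in> U \<inter> chart_dom ?C. R p \<in> chart_dom ?P}"
  note sc = smooth_map_on_charts[OF fd2 fd2 TQ smooth_atlas_product[OF fd fd Q Q] R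
      tangent_chart_in[OF c(1)] prod_chart_in[OF ab(1,2)], folded W_def]
  \<comment> \<open>The lift at \<open>x\<close> evaluates the tangent map of \<open>R\<close> over
    the base point of \<open>?\<kappa> x\<close>. On \<open>X\<close> this point lies in
    \<open>W\<close>, where \<open>R\<close> has the chosen coordinate expression.\<close>
  define X where "X = ?\<kappa> ` tangent_over (tangent_bundle Q) W"
  have Wsub: "W \<subseteq> chart_dom ?C" by (auto simp: W_def)
  note X = involution_image_chart[OF fd Q c(1) Wsub sc(1), folded X_def]
  have WU: "tangent_over (tangent_bundle Q) W \<subseteq> tangent_over (tangent_bundle Q) U"
    by (auto simp: W_def tangent_over_def)
  have \<kappa>W: "fst (?\<kappa> x) \<in> W" if x: "x \<in> X" for x
  proof -
    obtain y where y: "y \<in> tangent_over (tangent_bundle Q) W" "x = ?\<kappa> y"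
      using x by (auto simp: X_def)
    have "y \<in> carrier (tangent_bundle (tangent_bundle Q))"
      using y(1) WU Uc unfolding carrier_tangent_bundle[of "tangent_bundle Q"] by (auto simp: tangent_over_def)
    then show ?thesis
      using y canonical_involution_involutive[OF fd Q] by (auto simp: tangent_over_def)
  qed
  have lift: "tangent_lift Q R x \<in> chart_dom (prod_chart (tangent_chart Q a) (tangent_chart Q b))"
    if x: "x \<in> X" for x
  proof -
    have "x \<in> chart_dom (double_chart Q c)" "fst (?\<kappa> x) \<in> U" "R (fst (?\<kappa> x)) \<in> chart_dom ?P"
      using X(1) \<kappa>W[OF x] x unfolding W_def by blast+
    then show ?thesis
      by (rule tangent_lift_chart(1)[OF fd Q c(1) ab(1,2) R])
  qed
  let ?S = "chart_map ?C ` W"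
  have oS: "open ?S"
    by (rule open_image_openin[OF TQ tangent_chart_in[OF c(1)] sc(1) Wsub])
  have oSU: "open (?S \<times> (UNIV :: ('e \<times> 'e) set))"
    by (intro open_Times oS open_UNIV)
  have ofl: "open (flip ` (?S \<times> (UNIV :: ('e \<times> 'e) set)))"
    by (rule open_flip_image[OF oSU])
  have "flip ` flip ` (?S \<times> UNIV) \<subseteq> ?S \<times> UNIV"
    by (auto simp: image_image)
  from smooth_on_compose[OF fin_dim_prod[OF fd2 fd2] ofl oSU this
      smooth_on_bounded_linear[OF bounded_linear_flip ofl] smooth_on_tangent_fun[OF fd2 oS sc(2)]]
  have sm: "smooth_on (\<lambda>y. flip (tangent_fun (coord_map ?C ?P R) (flip y))) (chart_map (double_chart Q c) ` X)"
    unfolding X(2) by (rule smooth_on_linear_compose[OF bounded_linear_flip ofl])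
  have eq: "flip (tangent_fun (coord_map ?C ?P R) (flip y)) =
      coord_map (double_chart Q c) (prod_chart (tangent_chart Q a) (tangent_chart Q b)) (tangent_lift Q R) y"
    if "y \<in> chart_map (double_chart Q c) ` X" for y
    by (rule coord_map_tangent_lift[OF fd Q c(1) ab(1,2) R, symmetric])
      (use that in \<open>unfold X(2) W_def\<close>)
  have op: "open (chart_map (double_chart Q c) ` X)"
    unfolding X(2) by (rule ofl)
  have "smooth_on (coord_map (double_chart Q c) (prod_chart (tangent_chart Q a) (tangent_chart Q b))
      (tangent_lift Q R)) (chart_map (double_chart Q c) ` X)"
    by (rule smooth_on_cong[OF op eq sm])
  moreover have "z \<in> X"
    using w wU c(2) ab(3) by (auto simp: X_def W_def tangent_over_def)
  moreover have "X \<subseteq> ?\<kappa> ` tangent_over (tangent_bundle Q) U \<inter> chart_dom (double_chart Q c)"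
    using X(1) WU unfolding X_def by blast
  moreover have "tangent_lift Q R ` X \<subseteq> chart_dom (prod_chart (tangent_chart Q a) (tangent_chart Q b))"
    using lift by blast
  ultimately show "\<exists>C\<in>tangent_bundle (tangent_bundle Q).
      \<exists>D\<in>product_manifold (tangent_bundle Q) (tangent_bundle Q). \<exists>X.
      openin (atlas_topology (tangent_bundle (tangent_bundle Q))) X \<and> z \<in> X \<and>
      X \<subseteq> ?\<kappa> ` tangent_over (tangent_bundle Q) U \<inter> chart_dom C \<and>
      tangent_lift Q R ` X \<subseteq> chart_dom D \<and>
      smooth_on (coord_map C D (tangent_lift Q R)) (chart_map C ` X)"
    using X(3) by (intro bexI[OF _ double_chart_in[OF c(1)]]
        bexI[OF _ prod_chart_in[OF tangent_chart_in[OF ab(1)] tangent_chart_in[OF ab(2)]]] exI[of _ X] conjI)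
qed

section \<open>Derivatives along the fibres\<close>

lemma chart_inv_fibre_chart:
  assumes M: "smooth_atlas M" and c: "c \<in> M" "x \<in> chart_dom c"
  shows "chart_inv (Chart (tangent_space M x) (\<lambda>v. v c)) e = tangent_vector M x c e"
  unfolding chart_inv_def
  by (rule inv_into_f_eq)
    (auto intro: inj_onI tangent_space_eqI c tangent_vector_in_tangent_space[OF M c] tangent_vector_at[OF M c])

lemma fibre_chart_image:
  assumes M: "smooth_atlas M" and c: "c \<in> M" "x \<in> chart_dom c"
  shows "(\<lambda>v. v c) ` tangent_space M x = UNIV"
proof (intro subset_antisym subset_UNIV subsetI)
  fix e
  show "e \<in> (\<lambda>v. v c) ` tangent_space M x"
    by (rule image_eqI[where x = "tangent_vector M x c e"])
      (simp_all add: tangent_vector_at[OF M c] tangent_vector_in_tangent_space[OF M c])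
qed

lemma fibre_transition:
  assumes M: "smooth_atlas M" and c: "c \<in> M" "x \<in> chart_dom c" and d: "d \<in> M" "x \<in> chart_dom d"
  shows "transition (Chart (tangent_space M x) (\<lambda>v. v c)) (Chart (tangent_space M x) (\<lambda>v. v d)) =
    frechet_derivative (transition c d) (at (chart_map c x))"
  using d by (simp add: fun_eq_iff chart_inv_fibre_chart[OF M c] tangent_vector_def)

text \<open>Each chart is a bijection of the fibre onto the whole model space, and the transitions
  are derivatives of transition maps of \<open>M\<close>, hence bounded linear.\<close>

lemma smooth_atlas_fibre_manifold:
  assumes M: "smooth_atlas M"
  shows "smooth_atlas (fibre_manifold M x)"
  unfolding smooth_atlas_def
proof (intro conjI ballI)
  fix k assume "k \<in> fibre_manifold M x"
  then obtain c where c: "c \<in> M" "x \<in> chart_dom c" "k = Chart (tangent_space M x) (\<lambda>v. v c)"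
    by (auto simp: fibre_manifold_def)
  show "inj_on (chart_map k) (chart_dom k)"
    unfolding c by (auto intro: inj_onI tangent_space_eqI c)
  show "open (chart_map k ` chart_dom k)"
    unfolding c by (simp add: fibre_chart_image[OF M c(1,2)])
  fix l assume "l \<in> fibre_manifold M x"
  then obtain d where d: "d \<in> M" "x \<in> chart_dom d" "l = Chart (tangent_space M x) (\<lambda>v. v d)"
    by (auto simp: fibre_manifold_def)
  show "open (chart_map k ` (chart_dom k \<inter> chart_dom l))"
    unfolding c d by (simp add: fibre_chart_image[OF M c(1,2)])
  show "smooth_on (transition k l) (chart_map k ` (chart_dom k \<inter> chart_dom l))"
    unfolding c d fibre_transition[OF M c(1,2) d(1,2)]
    using has_derivative_bounded_linear[OF has_derivative_transition[OF M c(1) d(1) c(2) d(2)]]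
    by (simp add: fibre_chart_image[OF M c(1,2)] smooth_on_bounded_linear)
qed

text \<open>Transitions between fibre charts are linear and thus their own derivatives.
  Compatibility of the components in fibre charts is therefore that of \<open>v\<close>
  itself.\<close>

lemma fibre_iso_in_tangent_space:
  assumes M: "smooth_atlas M" and v: "v \<in> tangent_space M x"
  shows "snd (fibre_iso M x v) \<in> tangent_space (fibre_manifold M x) (\<lambda>c. 0)"
  unfolding tangent_space_def
proof (intro CollectI conjI ballI allI impI)
  fix k l assume kl: "k \<in> fibre_manifold M x" "l \<in> fibre_manifold M x"
  then obtain c d where cd: "c \<in> M" "x \<in> chart_dom c" "k = Chart (tangent_space M x) (\<lambda>v. v c)"
    "d \<in> M" "x \<in> chart_dom d" "l = Chart (tangent_space M x) (\<lambda>v. v d)"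
    by (auto simp: fibre_manifold_def)
  let ?L = "frechet_derivative (transition c d) (at (chart_map c x))"
  have "frechet_derivative ?L (at y) = ?L" for y
    by (rule frechet_derivative_at[symmetric], rule bounded_linear_imp_has_derivative,
        rule has_derivative_bounded_linear[OF has_derivative_transition[OF M cd(1,4,2,5)]])
  then show "snd (fibre_iso M x v) l =
      frechet_derivative (transition k l) (at (chart_map k (\<lambda>c. 0))) (snd (fibre_iso M x v) k)"
    using kl tangent_space_transition[OF v cd(1,4,2,5)]
    unfolding cd(3,6) fibre_transition[OF M cd(1,2,4,5)] by (simp add: fibre_iso_def)
next
  \<comment> \<open>The origin belongs to the domain of every fibre chart, so only the default value
    off the atlas is left.\<close>
  fix k assume "k \<notin> fibre_manifold M x \<or> (\<lambda>c. 0) \<notin> chart_dom k"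
  then show "snd (fibre_iso M x v) k = 0"
    using zero_in_tangent_space[OF M, of x] by (auto simp: fibre_iso_def fibre_manifold_def)
qed

text \<open>In charts the inclusion of the fibre is \<open>e \<mapsto> (chart_map c x, e)\<close>,
  so the fibre derivative is a partial derivative in the second variable.\<close>

lemma fibre_derivative_at:
  assumes M: "smooth_atlas M" and c: "c \<in> M" "x \<in> chart_dom c" and v: "v \<in> tangent_space M x"
    and d: "d \<in> M" "f (zero_vector x) \<in> chart_dom d"
    and diff: "coord_map (tangent_chart M c) d f differentiable (at (chart_map c x, 0))"
  shows "fibre_derivative M f x v d =
    frechet_derivative (coord_map (tangent_chart M c) d f) (at (chart_map c x, 0)) (0, v c)"
proof -
  let ?k = "Chart (tangent_space M x) (\<lambda>v. v c)" and ?F = "coord_map (tangent_chart M c) d f"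
  have k: "?k \<in> fibre_manifold M x"
    using c by (auto simp: fibre_manifold_def)
  have "coord_map ?k d (\<lambda>w. f (x, w)) = (\<lambda>e. ?F (chart_map c x, e))"
    by (simp add: fun_eq_iff chart_inv_fibre_chart[OF M c] chart_inv_tangent_chart[OF M c])
  moreover have "((\<lambda>e. (chart_map c x, e)) has_derivative (\<lambda>e. (0, e))) (at 0)"
    by (auto intro!: derivative_eq_intros)
  from has_derivative_compose[OF this diff[unfolded frechet_derivative_works]]
  have "((\<lambda>e. ?F (chart_map c x, e)) has_derivative
      (\<lambda>e. frechet_derivative ?F (at (chart_map c x, 0)) (0, e))) (at 0)" .
  ultimately have D: "(coord_map ?k d (\<lambda>w. f (x, w)) has_derivative
      (\<lambda>e. frechet_derivative ?F (at (chart_map c x, 0)) (0, e))) (at (chart_map ?k (\<lambda>c. 0)))"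
    by simp
  have "fibre_derivative M f x v d =
      snd (tangent_map (fibre_manifold M x) M (\<lambda>w. f (x, w)) (\<lambda>c. 0, snd (fibre_iso M x v))) d"
    by (simp add: fibre_derivative_def fibre_iso_def)
  also have "\<dots> = frechet_derivative (coord_map ?k d (\<lambda>w. f (x, w))) (at (chart_map ?k (\<lambda>c. 0)))
      (snd (fibre_iso M x v) ?k)"
    by (rule tangent_map_at[OF smooth_atlas_fibre_manifold[OF M] k _ fibre_iso_in_tangent_space[OF M v] d(1)])
      (use d(2) zero_in_tangent_space[OF M] differentiableI[OF D] in \<open>auto simp: zero_vector_def\<close>)
  also have "\<dots> = frechet_derivative ?F (at (chart_map c x, 0)) (0, v c)"
    unfolding frechet_derivative_at[OF D, symmetric] using k by (simp add: fibre_iso_def)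
  finally show ?thesis .
qed

lemma fibre_derivative_outside:
  "d \<notin> M \<or> f (zero_vector x) \<notin> chart_dom d \<Longrightarrow> fibre_derivative M f x v d = 0"
  by (auto simp: fibre_derivative_def tangent_map_def fibre_iso_def zero_vector_def)

text \<open>Both components of \<open>R\<close> send the zero vector to \<open>x\<close>, so one
  chart \<open>c\<close> serves for both. The difference of two tangent vectors then becomes the
  derivative of a difference of coordinate maps.\<close>

lemma fibre_derivative_diff:
  fixes M :: "('a, 'e::real_inner) atlas"
  assumes fd: "fin_dim TYPE('e)" and M: "smooth_atlas M" and c: "c \<in> M" "x \<in> chart_dom c"
    and v: "v \<in> tangent_space M x"
    and R: "smooth_map_on (tangent_bundle M) (product_manifold M M) U R"
    and zero: "zero_vector x \<in> U" "R (zero_vector x) = (x, x)"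
  defines "r \<equiv> coord_map (tangent_chart M c) (prod_chart c c) R"
  shows "(r has_derivative frechet_derivative r (at (chart_map c x, 0))) (at (chart_map c x, 0))"
    and "fibre_derivative M (snd \<circ> R) x v c - fibre_derivative M (fst \<circ> R) x v c =
      frechet_derivative (\<lambda>z. snd (r z) - fst (r z)) (at (chart_map c x, 0)) (0, v c)"
proof -
  let ?z = "(chart_map c x, 0 :: 'e)"
  have "smooth_on r (chart_map (tangent_chart M c) `
      {p \<in> U \<inter> chart_dom (tangent_chart M c). R p \<in> chart_dom (prod_chart c c)})"
    unfolding r_def
    by (rule smooth_map_on_charts(2)[OF fin_dim_prod[OF fd fd] fin_dim_prod[OF fd fd]
          smooth_atlas_tangent_bundle[OF fd M] smooth_atlas_product[OF fd fd M M] R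
          tangent_chart_in[OF c(1)] prod_chart_in[OF c(1) c(1)]])
  moreover have "?z \<in> chart_map (tangent_chart M c) `
      {p \<in> U \<inter> chart_dom (tangent_chart M c). R p \<in> chart_dom (prod_chart c c)}"
    by (rule image_eqI[of _ _ "zero_vector x"])
      (use zero c zero_in_tangent_space[OF M] in \<open>auto simp: zero_vector_def\<close>)
  ultimately show r: "(r has_derivative frechet_derivative r (at ?z)) (at ?z)"
    by (rule smooth_on_has_derivative)
  have co: "coord_map (tangent_chart M c) c (fst \<circ> R) = (\<lambda>z. fst (r z))"
    "coord_map (tangent_chart M c) c (snd \<circ> R) = (\<lambda>z. snd (r z))"
    by (simp_all add: r_def fun_eq_iff chart_map_prod_chart)
  note D1 = has_derivative_fst[OF r] and D2 = has_derivative_snd[OF r]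
  have "fibre_derivative M (fst \<circ> R) x v c = fst (frechet_derivative r (at ?z) (0, v c))"
    using fibre_derivative_at[OF M c v c(1), of "fst \<circ> R", unfolded co] zero c differentiableI[OF D1]
      fun_cong[OF frechet_derivative_at[OF D1], of "(0, v c)"] by simp
  moreover have "fibre_derivative M (snd \<circ> R) x v c = snd (frechet_derivative r (at ?z) (0, v c))"
    using fibre_derivative_at[OF M c v c(1), of "snd \<circ> R", unfolded co] zero c differentiableI[OF D2]
      fun_cong[OF frechet_derivative_at[OF D2], of "(0, v c)"] by simp
  ultimately show "fibre_derivative M (snd \<circ> R) x v c - fibre_derivative M (fst \<circ> R) x v c =
      frechet_derivative (\<lambda>z. snd (r z) - fst (r z)) (at ?z) (0, v c)"
    using fun_cong[OF frechet_derivative_at[OF has_derivative_diff[OF D2 D1]], of "(0, v c)"] by simp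
qed

section \<open>Discretization maps in charts\<close>

text \<open>The normalization is stated on all of the chart image, not at a single point, since
  these identities are later differentiated with respect to \<open>y\<close>.\<close>

lemma discretization_map_coord:
  fixes Q :: "('a, 'e::real_inner) atlas"
  assumes R: "discretization_map Q U R" and c: "c \<in> Q" and y: "y \<in> chart_map c ` chart_dom c"
  defines "r \<equiv> coord_map (tangent_chart Q c) (prod_chart c c) R"
  shows "(y, 0) \<in> chart_map (tangent_chart Q c) `
      {p \<in> U \<inter> chart_dom (tangent_chart Q c). R p \<in> chart_dom (prod_chart c c)}"
    and "r (y, 0) = (y, y)"
    and "frechet_derivative (\<lambda>z. snd (r z) - fst (r z)) (at (y, 0)) (0, e) = e"
proof -
  have Q: "smooth_atlas Q" and fd: "fin_dim TYPE('e)"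
    using R by (auto simp: discretization_map_def smooth_manifold_def fin_dim_def)
  have RU: "smooth_map_on (tangent_bundle Q) (product_manifold Q Q) U R"
    using R by (simp add: discretization_map_def)
  obtain x where x: "x \<in> chart_dom c" "y = chart_map c x"
    using y by auto
  then have "x \<in> carrier Q"
    using c by (auto simp: carrier_def)
  then have zero: "zero_vector x \<in> U" "R (zero_vector x) = (x, x)"
    and diff: "\<And>v. v \<in> tangent_space Q x \<Longrightarrow>
      (\<lambda>c. fibre_derivative Q (snd \<circ> R) x v c - fibre_derivative Q (fst \<circ> R) x v c) = v"
    using R by (auto simp: discretization_map_def)
  have zc: "zero_vector x \<in> chart_dom (tangent_chart Q c)" "chart_map (tangent_chart Q c) (zero_vector x) = (y, 0)"
    using x zero_in_tangent_space[OF Q] by (auto simp: zero_vector_def)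
  show "(y, 0) \<in> chart_map (tangent_chart Q c) `
      {p \<in> U \<inter> chart_dom (tangent_chart Q c). R p \<in> chart_dom (prod_chart c c)}"
    by (rule image_eqI[of _ _ "zero_vector x"]) (use zc zero x in auto)
  have "chart_inv (tangent_chart Q c) (y, 0) = zero_vector x"
    using chart_inv_map[OF smooth_atlas_tangent_bundle[OF fd Q] tangent_chart_in[OF c] zc(1)] zc(2) by simp
  then show "r (y, 0) = (y, y)"
    using zero x by (simp add: r_def chart_map_prod_chart)
  let ?v = "tangent_vector Q x c e"
  have v: "?v \<in> tangent_space Q x" "?v c = e"
    using tangent_vector_in_tangent_space[OF Q c x(1)] tangent_vector_at[OF Q c x(1)] by auto
  show "frechet_derivative (\<lambda>z. snd (r z) - fst (r z)) (at (y, 0)) (0, e) = e"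
    using fibre_derivative_diff(2)[OF fd Q c x(1) v(1) RU zero, folded r_def x(2)] fun_cong[OF diff[OF v(1)], of c]
      v(2) by simp
qed

lemma zero_vector_double_chart:
  fixes Q :: "('a, 'e::real_inner) atlas"
  assumes fd: "fin_dim TYPE('e)" and Q: "smooth_atlas Q" and x: "x \<in> chart_dom (tangent_chart Q c)"
  shows "zero_vector x \<in> chart_dom (double_chart Q c)"
    and "chart_map (double_chart Q c) (zero_vector x) = ((chart_map c (fst x), snd x c), (0, 0))"
proof -
  show "zero_vector x \<in> chart_dom (double_chart Q c)"
    using x zero_in_tangent_space[OF smooth_atlas_tangent_bundle[OF fd Q]]
    by (simp add: zero_vector_def)
  show "chart_map (double_chart Q c) (zero_vector x) = ((chart_map c (fst x), snd x c), (0, 0))"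
    by (cases x) (simp add: zero_vector_def zero_prod_def)
qed

text \<open>The coordinates \<open>((q, v), (0, 0))\<close> become \<open>((q, 0), (v, 0))\<close>,
  whose base point is the zero vector at \<open>q\<close>. This places the zero section of the
  double tangent bundle in the domain of the lift.\<close>

lemma fst_involution_zero_vector:
  fixes Q :: "('a, 'e::real_inner) atlas"
  assumes fd: "fin_dim TYPE('e)" and Q: "smooth_atlas Q" and c: "c \<in> Q" and x: "x \<in> chart_dom (tangent_chart Q c)"
  shows "fst (canonical_involution Q (zero_vector x)) = zero_vector (fst x)"
proof -
  note z = zero_vector_double_chart[OF fd Q x]
  note k = canonical_involution_chart[OF fd Q c z(1)]
  let ?w = "fst (canonical_involution Q (zero_vector x))"
  have w: "?w \<in> chart_dom (tangent_chart Q c)"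
    using k(1) unfolding chart_dom_tangent_chart[of "tangent_bundle Q"] by (metis SigmaE fst_conv)
  have "chart_map (tangent_chart Q c) ?w = fst (chart_map (double_chart Q c) (canonical_involution Q (zero_vector x)))"
    by (metis chart_map_tangent_chart fst_conv prod.collapse)
  also have "\<dots> = chart_map (tangent_chart Q c) (zero_vector (fst x))"
    unfolding k(2) z(2) by (simp add: zero_vector_def)
  finally show ?thesis
    using w x zero_in_tangent_space[OF Q]
    by (intro inj_onD[OF inj_on_tangent_chart[OF Q c]]) (auto simp: zero_vector_def)
qed

lemma tangent_lift_zero_vector:
  fixes Q :: "('a, 'e::real_inner) atlas"
  assumes R: "discretization_map Q U R" and x: "x \<in> carrier (tangent_bundle Q)"
  shows "tangent_lift Q R (zero_vector x) = (x, x)"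
proof -
  have Q: "smooth_atlas Q" and fd: "fin_dim TYPE('e)"
    using R by (auto simp: discretization_map_def smooth_manifold_def fin_dim_def)
  have RU: "smooth_map_on (tangent_bundle Q) (product_manifold Q Q) U R"
    using R by (simp add: discretization_map_def)
  note TQ = smooth_atlas_tangent_bundle[OF fd Q]
  obtain c where c: "c \<in> Q" "fst x \<in> chart_dom c" "x \<in> chart_dom (tangent_chart Q c)"
    using x by (rule tangent_bundle_obtain_chart)
  let ?C = "tangent_chart Q c"
  let ?W = "{p \<in> U \<inter> chart_dom ?C. R p \<in> chart_dom (prod_chart c c)}"
  define r where "r = coord_map ?C (prod_chart c c) R"
  define q where "q = chart_map c (fst x)"
  note co = discretization_map_coord[OF R c(1), folded r_def]
  have q: "q \<in> chart_map c ` chart_dom c" using c by (simp add: q_def)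
  have xQ: "fst x \<in> carrier Q" using c by (auto simp: carrier_def)
  have zero: "zero_vector (fst x) \<in> U" "R (zero_vector (fst x)) = (fst x, fst x)"
    using R xQ by (auto simp: discretization_map_def)
  note z = zero_vector_double_chart[OF fd Q c(3), folded q_def]
  have "fst (canonical_involution Q (zero_vector x)) \<in> U"
    "R (fst (canonical_involution Q (zero_vector x))) \<in> chart_dom (prod_chart c c)"
    using zero c(2) by (simp_all add: fst_involution_zero_vector[OF fd Q c(1,3)])
  note l = tangent_lift_chart[OF fd Q c(1) c(1) c(1) RU z(1) this, folded r_def]
  have D: "(r has_derivative frechet_derivative r (at (q, 0))) (at (q, 0))"
    unfolding r_def
    by (rule smooth_on_has_derivative[OF smooth_map_on_charts(2)[OF fin_dim_prod[OF fd fd] fin_dim_prod[OF fd fd]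
            TQ smooth_atlas_product[OF fd fd Q Q] RU tangent_chart_in[OF c(1)] prod_chart_in[OF c(1) c(1)]]
          co(1)[OF q]])
  have "((\<lambda>y. (y, 0::'e)) has_derivative (\<lambda>v. (v, 0))) (at q)"
    by (auto intro!: derivative_eq_intros)
  from has_derivative_compose[OF this D]
  \<comment> \<open>The restriction of \<open>r\<close> to the zero section is differentiated in two
    ways: by the chain rule, and as the diagonal map.\<close>
  have d1: "((\<lambda>y. r (y, 0)) has_derivative (\<lambda>v. frechet_derivative r (at (q, 0)) (v, 0))) (at q)" .
  have d2: "((\<lambda>y. r (y, 0)) has_derivative (\<lambda>v. (v, v))) (at q)"
    by (rule has_derivative_transform_within_open[OF _ open_chart_image[OF Q c(1)] q co(2)[symmetric]])
      (auto intro!: derivative_eq_intros)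
  have Dr: "frechet_derivative r (at (q, 0)) (v, 0) = (v, v)" for v
    using fun_cong[OF has_derivative_unique[OF d1 d2]] .
  \<comment> \<open>The tangent map of \<open>r\<close> yields \<open>((q, q), (v, v))\<close> with
    \<open>v = snd x c\<close>, and the outer \<open>flip\<close> regroups this into two copies of
    the coordinates of \<open>x\<close>.\<close>
  have "chart_map (prod_chart ?C ?C) (tangent_lift Q R (zero_vector x)) = ((q, snd x c), (q, snd x c))"
    unfolding l(2) z(2) by (simp add: tangent_fun_def co(2)[OF q] Dr)
  also have "\<dots> = chart_map (prod_chart ?C ?C) (x, x)"
    by (cases x) (simp add: chart_map_prod_chart q_def)
  finally show ?thesis
    using c(3) l(1) inj_on_tangent_chart[OF Q c(1)]
    by (intro inj_onD[OF inj_on_prod_chart[of ?C ?C]]) auto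
qed

text \<open>In a chart the difference of the two components of the lift is \<open>tangent_fun s \<circ> flip\<close> with
  \<open>s = R\<^sup>2 - R\<^sup>1\<close>.\<close>

lemma fibre_derivative_tangent_lift:
  fixes Q :: "('a, 'e::real_inner) atlas"
  assumes R: "discretization_map Q U R" and x: "x \<in> carrier (tangent_bundle Q)"
    and V: "V \<in> tangent_space (tangent_bundle Q) x"
    and zero: "zero_vector x \<in> canonical_involution Q ` tangent_over (tangent_bundle Q) U"
  shows "fibre_derivative (tangent_bundle Q) (snd \<circ> tangent_lift Q R) x V C -
    fibre_derivative (tangent_bundle Q) (fst \<circ> tangent_lift Q R) x V C = V C"
proof (cases "C \<in> tangent_bundle Q \<and> x \<in> chart_dom C")
  \<comment> \<open>The lift sends the zero vector to \<open>(x, x)\<close>. In a chart that does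
    not contain \<open>x\<close>, both fibre derivatives and \<open>V\<close> have the default value
    0.\<close>
  case False
  then show ?thesis
    using tangent_space_outside[OF V] tangent_lift_zero_vector[OF R x]
    by (simp add: fibre_derivative_outside)
next
  case True
  then obtain c where c: "c \<in> Q" "C = tangent_chart Q c" and xC: "x \<in> chart_dom (tangent_chart Q c)"
    by (auto simp: tangent_bundle_def)
  have Q: "smooth_atlas Q" and fd: "fin_dim TYPE('e)"
    using R by (auto simp: discretization_map_def smooth_manifold_def fin_dim_def)
  have RU: "smooth_map_on (tangent_bundle Q) (product_manifold Q Q) U R"
    using R by (simp add: discretization_map_def)
  note TQ = smooth_atlas_tangent_bundle[OF fd Q]
  note fd2 = fin_dim_prod[OF fd fd]
  let ?C = "tangent_chart Q c"
  define W where "W = {p \<in> U \<inter> chart_dom ?C. R p \<in> chart_dom (prod_chart c c)}"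
  define r where "r = coord_map ?C (prod_chart c c) R"
  define l where "l = coord_map (double_chart Q c) (prod_chart ?C ?C) (tangent_lift Q R)"
  define S where "S = chart_map ?C ` W"
  define s where "s z = snd (r z) - fst (r z)" for z
  define q where "q = chart_map c (fst x)"
  define v where "v = snd x c"
  note co = discretization_map_coord[OF R c(1), folded r_def W_def, folded S_def, folded s_def]
  have q: "q \<in> chart_map c ` chart_dom c" using xC by (auto simp: q_def)
  note sc = smooth_map_on_charts[OF fd2 fd2 TQ smooth_atlas_product[OF fd fd Q Q] RU
      tangent_chart_in[OF c(1)] prod_chart_in[OF c(1) c(1)], folded W_def r_def, folded S_def]
  have S: "open S"
    unfolding S_def by (rule open_image_openin[OF TQ tangent_chart_in[OF c(1)] sc(1)]) (auto simp: W_def)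
  have s: "smooth_on s S"
    unfolding s_def
    by (rule smooth_on_linear_compose[OF _ S sc(2), of "\<lambda>z. snd z - fst z"])
      (intro bounded_linear_sub bounded_linear_snd bounded_linear_fst)
  have Cx: "chart_map ?C x = (q, v)"
    by (cases x) (simp add: q_def v_def)
  let ?P = "((q, v), (0, 0))"
  note ts = frechet_derivative_tangent_fun_flip[OF fd S s open_chart_image[OF Q c(1)] q co(1) co(3), of v]
  note fdd = fibre_derivative_diff[OF fd2 TQ tangent_chart_in[OF c(1)] xC V smooth_map_on_tangent_lift[OF fd Q RU]
      zero tangent_lift_zero_vector[OF R x], folded l_def, unfolded Cx zero_prod_def]
  have l: "(l has_derivative frechet_derivative l (at ?P)) (at ?P)"
    by (rule fdd(1))
  \<comment> \<open>The outer \<open>flip\<close> regroups the tangent map of \<open>r\<close> into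
    the tangent maps of its two components, and taking tangent maps commutes with their
    difference.\<close>
  have eq: "tangent_fun s (flip y) = snd (l y) - fst (l y)" if y: "y \<in> flip ` (S \<times> UNIV)" for y
  proof -
    obtain a b where ab: "a \<in> S" "flip y = (a, b)"
      using y by auto
    note ra = smooth_on_has_derivative[OF sc(2) ab(1)]
    have "tangent_fun s (a, b) = (s a, snd (frechet_derivative r (at a) b) - fst (frechet_derivative r (at a) b))"
      unfolding s_def[abs_def]
      by (rule tangent_fun_eq[OF has_derivative_diff[OF has_derivative_snd[OF ra] has_derivative_fst[OF ra]]])
    moreover have "l y = flip (tangent_fun r (a, b))"
      unfolding l_def r_def ab(2)[symmetric]
      by (rule coord_map_tangent_lift[OF fd Q c(1) c(1) c(1) RU]) (use y in \<open>unfold S_def W_def\<close>)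
    ultimately show ?thesis
      using ab(2) by (simp add: s_def tangent_fun_def flip_def case_prod_beta)
  qed
  have P: "?P \<in> flip ` (S \<times> UNIV)"
    by (rule image_eqI[of _ _ "((q, 0), (v, 0))"]) (use co(1)[OF q] in simp_all)
  have "open (flip ` (S \<times> (UNIV :: ('e \<times> 'e) set)))"
    by (intro open_flip_image open_Times S open_UNIV)
  from has_derivative_transform_within_open[OF ts(1) this P, of "\<lambda>y. snd (l y) - fst (l y)"] eq
  have "((\<lambda>y. snd (l y) - fst (l y)) has_derivative
      frechet_derivative (tangent_fun s \<circ> flip) (at ?P)) (at ?P)"
    by simp
  from fun_cong[OF frechet_derivative_at[OF this], of "(0, V C)"]
  have "frechet_derivative (\<lambda>y. snd (l y) - fst (l y)) (at ?P) (0, V C) = V C"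
    using ts(2)[of "fst (V C)" "snd (V C)"] by simp
  then show ?thesis
    using fdd(2) unfolding c(2) by (simp add: zero_prod_def)
qed

theorem proposition3p3:
  fixes Q :: "('a, 'e::real_inner) atlas"
    and U :: "('a, 'e) tangent set"
    and R :: "('a, 'e) tangent \<Rightarrow> 'a \<times> 'a"
  assumes "smooth_manifold Q"
    and "discretization_map Q U R"
  shows "discretization_map (tangent_bundle Q)
           (canonical_involution Q ` tangent_over (tangent_bundle Q) U)
           (tangent_lift Q R)"
proof -
  note fd = fin_dim_smooth_manifold[OF assms(1)]
  have Q: "smooth_atlas Q"
    using assms(1) by (simp add: smooth_manifold_def)
  have U: "openin (atlas_topology (tangent_bundle Q)) U" "\<And>p. p \<in> carrier Q \<Longrightarrow> zero_vector p \<in> U"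
    and RU: "smooth_map_on (tangent_bundle Q) (product_manifold Q Q) U R"
    using assms(2) by (auto simp: discretization_map_def)
  have zero: "zero_vector x \<in> canonical_involution Q ` tangent_over (tangent_bundle Q) U"
    if x: "x \<in> carrier (tangent_bundle Q)" for x
  proof -
    obtain c where c: "c \<in> Q" "fst x \<in> chart_dom c" "x \<in> chart_dom (tangent_chart Q c)"
      using x by (rule tangent_bundle_obtain_chart)
    note z = zero_vector_double_chart(1)[OF fd Q c(3)]
    \<comment> \<open>By involutivity \<open>?w\<close> is a preimage of the zero vector, and its
      base point is a zero vector of the tangent bundle of \<open>Q\<close>, hence in
      \<open>U\<close>.\<close>
    let ?w = "canonical_involution Q (zero_vector x)"
    have "fst ?w \<in> U"
      using U(2) c unfolding fst_involution_zero_vector[OF fd Q c(1,3)] by (auto simp: carrier_def)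
    moreover have "snd ?w \<in> tangent_space (tangent_bundle Q) (fst ?w)"
      using canonical_involution_chart(1)[OF fd Q c(1) z]
      unfolding chart_dom_tangent_chart[of "tangent_bundle Q"] by (metis SigmaE fst_conv snd_conv)
    ultimately have "?w \<in> tangent_over (tangent_bundle Q) U"
      unfolding tangent_over_def by (metis SigmaI prod.collapse)
    then show ?thesis
      using canonical_involution_involutive[OF fd Q double_chart_carrier[OF c(1) z]] by (metis image_eqI)
  qed
  show ?thesis
    unfolding discretization_map_def
  proof (intro conjI ballI ext)
    show "smooth_manifold (tangent_bundle Q)"
      by (rule smooth_manifold_tangent_bundle[OF assms(1)])
    show "openin (atlas_topology (tangent_bundle (tangent_bundle Q)))
        (canonical_involution Q ` tangent_over (tangent_bundle Q) U)"
      by (rule openin_involution_image[OF fd Q U(1)])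
    show "smooth_map_on (tangent_bundle (tangent_bundle Q)) (product_manifold (tangent_bundle Q) (tangent_bundle Q))
        (canonical_involution Q ` tangent_over (tangent_bundle Q) U) (tangent_lift Q R)"
      by (rule smooth_map_on_tangent_lift[OF fd Q RU])
  qed (use zero tangent_lift_zero_vector[OF assms(2)] fibre_derivative_tangent_lift[OF assms(2)] in blast)+
qed

end
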